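(* The linear map $\Psi:M(0)\to\mathrm{Sym}\,A^2(\mathbb D)$ is isometric with respect to $(-,-)_M$ on $M(0)$ and the inner product $(-,-)_A$ on $\mathrm{Sym}\,A^2(\mathbb D)$.
   Context: $\mathbb D$ is the open unit disk; $A^2(\mathbb D)$ is the Hilbert space of holomorphic functions in $L^2(\mathbb D,\frac1\pi dx_1dx_2)$. $A^2(\mathbb D)^{\hat\otimes p}$ is the Hilbert tensor power, $\hat S^p(f_1\otimes\cdots\otimes f_p)=\frac1{p!}\sum_{\sigma\in S_p}f_{\sigma(1)}\otimes\cdots\otimes f_{\sigma(p)}$ the orthogonal projection onto symmetric tensors, $\mathrm{Sym}^pA^2(\mathbb D)$ its image with the inherited inner product, $\mathrm{Sym}^0A^2(\mathbb D)=\mathbb C\mathbf 1$ with $\|\mathbf 1\|=1$, and $\mathrm{Sym}\,A^2(\mathbb D)=\bigoplus_{p\ge0}\mathrm{Sym}^pA^2(\mathbb D)$ (algebraic orthogonal direct sum) with inner product $(-,-)_A$. Let $\hat{\mathfrak h}=\bigoplus_{n\in\mathbb Z}\mathbb Ch\otimes t^n\oplus\mathbb Cc$ with $c$ central and $[h\otimes t^n,h\otimes t^m]=n\delta_{n+m,0}c$. $M(0)$ is the $\hat{\mathfrak h}$-module induced from $\mathbf 1$ with $(h\otimes t^n)\mathbf 1=0$ for $n\ge0$ and $c\mathbf 1=\mathbf 1$; $h(n)$ denotes the action of $h\otimes t^n$. It has the unique vertex algebra structure with vacuum $\mathbf 1$ and $Y(h(-1)\mathbf 1,z)=\sum_nh(n)z^{-n-1}$;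 put $Y(\tfrac12h(-1)^2\mathbf 1,z)=\sum_nL(n)z^{-n-2}$. There is a unique symmetric bilinear form $(-,-)$ on $M(0)$ with $(\mathbf 1,\mathbf 1)=1$ and $(Y(a,z)b,c)=(b,Y(e^{zL(1)}(-z^{-2})^{L(0)}a,z^{-1})c)$. Let $\theta$ be the antilinear map with $\theta(h(-k_1)\cdots h(-k_n)\mathbf 1)=(-1)^nh(-k_1)\cdots h(-k_n)\mathbf 1$ for $k_i\ge1$, and $(a,b)_M=(\theta(a),b)$, a positive-definite sesquilinear form. With $h_j(z)=(j+1)z^j\in A^2(\mathbb D)$, $\Psi$ is the linear map with $\Psi(\mathbf 1)=\mathbf 1$ and, for $n\ge1$, $i_1>\cdots>i_n\ge0$, $k_1,\dots,k_n\ge1$, $p=k_1+\cdots+k_n$, $$\Psi(h(-i_1-1)^{k_1}\cdots h(-i_n-1)^{k_n}\mathbf 1)=\sqrt{p!}\,\hat S^p\big(h_{i_1}^{\otimes k_1}\otimes\cdots\otimes h_{i_n}^{\otimes k_n}\big).$$ *)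

theory Defs
  imports
    "HOL-Analysis.Analysis"
    "HOL-Library.Poly_Mapping"
    "HOL-Library.Function_Algebras"
    "HOL-Combinatorics.Permutations"
begin

section \<open>Free vector spaces\<close>

definition free_scale :: "complex \<Rightarrow> ('w \<Rightarrow>\<^sub>0 complex) \<Rightarrow> 'w \<Rightarrow>\<^sub>0 complex" where
  "free_scale c u = Poly_Mapping.map ((*) c) u"

lemma lookup_free_scale [simp]:
  "Poly_Mapping.lookup (free_scale c u) w = c * Poly_Mapping.lookup u w"
  by (simp add: free_scale_def Poly_Mapping.map.rep_eq when_def)

interpretation free: vector_space free_scale
  by standard (auto intro!: poly_mapping_eqI simp: lookup_add algebra_simps)


section \<open>The Bergman space of the unit disk\<close>

definition disk_measure :: "complex measure" where
  "disk_measure = density lborel (\<lambda>z. ennreal (indicator (ball 0 1) z / pi))"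

text \<open>A function on the open disk is represented by its extension by zero to the whole plane.\<close>

typedef bergman = "{f :: complex \<Rightarrow> complex.
    f holomorphic_on ball 0 1 \<and> (\<forall>z. z \<notin> ball 0 1 \<longrightarrow> f z = 0) \<and>
    integrable disk_measure (\<lambda>z. (cmod (f z))\<^sup>2)}"
  by (rule exI[of _ "\<lambda>_. 0"]) auto

setup_lifting type_definition_bergman

text \<open>All sesquilinear forms are antilinear in the first argument, as
  \<open>(a, b)\<^sub>M = (\<theta>(a), b)\<close> is.\<close>

lift_definition bergman_inner :: "bergman \<Rightarrow> bergman \<Rightarrow> complex"
  is "\<lambda>f g. LINT z|disk_measure. cnj (f z) * g z" .

lift_definition h_fun :: "nat \<Rightarrow> bergman"
  is "\<lambda>j z. if z \<in> ball 0 1 then of_nat (j + 1) * z ^ j else 0"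
proof -
  fix j :: nat
  let ?f = "\<lambda>z::complex. if z \<in> ball 0 1 then of_nat (j + 1) * z ^ j else 0"
  have hol: "?f holomorphic_on ball 0 1"
    by (rule holomorphic_transform[of "\<lambda>z. of_nat (j + 1) * z ^ j"])
      (auto intro!: holomorphic_intros)
  have "{z \<in> space lborel. z \<in> ball 0 1} \<in> sets (lborel :: complex measure)"
    by simp
  then have meas: "(\<lambda>z. (cmod (?f z))\<^sup>2) \<in> borel_measurable lborel"
    by (intro borel_measurable_power borel_measurable_norm measurable_If) auto
  have "integrable lborel (\<lambda>z::complex. indicator (ball 0 1) z * (real (j + 1))\<^sup>2 / pi)"
    by (intro integrable_divide integrable_mult_left)
      (auto simp: integrable_indicator_iff emeasure_bounded_finite[simplified])
  then have "integrable lborel (\<lambda>z. indicator (ball 0 1) z / pi * (cmod (?f z))\<^sup>2)"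
  proof (rule Bochner_Integration.integrable_bound)
    show "AE z in lborel. norm (indicator (ball 0 1) z / pi * (cmod (?f z))\<^sup>2)
        \<le> norm (indicator (ball 0 1) z * (real (j + 1))\<^sup>2 / pi)"
    proof (rule AE_I2)
      fix z :: complex
      show "norm (indicator (ball 0 1) z / pi * (cmod (?f z))\<^sup>2)
          \<le> norm (indicator (ball 0 1) z * (real (j + 1))\<^sup>2 / pi)"
      proof (cases "z \<in> ball 0 1")
        case True
        then have "cmod z ^ j \<le> 1" by (auto intro: power_le_one)
        then have "cmod (of_nat (j + 1) * z ^ j) \<le> real (j + 1)"
          by (simp add: norm_mult norm_power mult_left_le del: of_nat_add of_nat_Suc)
        then have "(cmod (of_nat (j + 1) * z ^ j))\<^sup>2 \<le> (real (j + 1))\<^sup>2"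
          by (rule power_mono) simp
        then show ?thesis
          using True by (simp add: divide_right_mono del: of_nat_add of_nat_Suc)
      qed simp
    qed
  qed (intro borel_measurable_times borel_measurable_divide borel_measurable_indicator meas, auto)
  then have "integrable disk_measure (\<lambda>z. (cmod (?f z))\<^sup>2)"
    unfolding disk_measure_def using meas
    by (subst integrable_density)
      (auto intro!: borel_measurable_divide borel_measurable_indicator)
  with hol show "?f holomorphic_on ball 0 1 \<and> (\<forall>z. z \<notin> ball 0 1 \<longrightarrow> ?f z = 0) \<and>
      integrable disk_measure (\<lambda>z. (cmod (?f z))\<^sup>2)"
    by simp
qed


section \<open>Hilbert tensor powers and the symmetric algebra\<close>

text \<open>
  The elementary tensor \<open>f\<^sub>1 \<otimes> \<cdots> \<otimes> f\<^sub>p\<close> is realised as the antilinear functional it induces,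
  \<open>(g\<^sub>1, \<dots>, g\<^sub>p) \<mapsto> (g\<^sub>1 \<otimes> \<cdots> \<otimes> g\<^sub>p, f\<^sub>1 \<otimes> \<cdots> \<otimes> f\<^sub>p) = \<Prod>\<^sub>i (g\<^sub>i, f\<^sub>i)\<close>.
  A functional on \<open>p\<close>-tuples is a function on lists vanishing on lists of length other than \<open>p\<close>.
\<close>

definition tensor :: "bergman list \<Rightarrow> bergman list \<Rightarrow> complex" where
  "tensor fs gs =
     (if length gs = length fs then \<Prod>i<length fs. bergman_inner (gs ! i) (fs ! i) else 0)"

definition tensor_sum :: "(bergman list \<Rightarrow>\<^sub>0 complex) \<Rightarrow> bergman list \<Rightarrow> complex" where
  "tensor_sum u gs = (\<Sum>fs\<in>Poly_Mapping.keys u. Poly_Mapping.lookup u fs * tensor fs gs)"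

definition alg_inner ::
  "(bergman list \<Rightarrow>\<^sub>0 complex) \<Rightarrow> (bergman list \<Rightarrow>\<^sub>0 complex) \<Rightarrow> complex" where
  "alg_inner u v = (\<Sum>gs\<in>Poly_Mapping.keys u. cnj (Poly_Mapping.lookup u gs) * tensor_sum v gs)"

definition alg_norm :: "(bergman list \<Rightarrow>\<^sub>0 complex) \<Rightarrow> real" where
  "alg_norm u = sqrt (Re (alg_inner u u))"

text \<open>
  The \<open>p\<close>-th Hilbert tensor power is the completion of the algebraic one.  A point of the
  completion is the limit functional of a Cauchy sequence of algebraic tensors; two Cauchy
  sequences have the same limit functional iff their difference tends to zero in norm.
\<close>

definition represents ::
  "nat \<Rightarrow> (nat \<Rightarrow> bergman list \<Rightarrow>\<^sub>0 complex) \<Rightarrow> (bergman list \<Rightarrow> complex) \<Rightarrow> bool" where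
  "represents p X \<phi> \<longleftrightarrow>
     (\<forall>n. \<forall>fs\<in>Poly_Mapping.keys (X n). length fs = p) \<and>
     (\<forall>e>0. \<exists>N. \<forall>m\<ge>N. \<forall>n\<ge>N. alg_norm (X m - X n) < e) \<and>
     (\<forall>gs. (\<lambda>n. tensor_sum (X n) gs) \<longlonglongrightarrow> \<phi> gs)"

definition tensor_power :: "nat \<Rightarrow> (bergman list \<Rightarrow> complex) set" where
  "tensor_power p = {\<phi>. \<exists>X. represents p X \<phi>}"

definition tensor_inner ::
  "nat \<Rightarrow> (bergman list \<Rightarrow> complex) \<Rightarrow> (bergman list \<Rightarrow> complex) \<Rightarrow> complex" where
  "tensor_inner p \<phi> \<psi> =
     (THE c. \<exists>X Y. represents p X \<phi> \<and> represents p Y \<psi> \<and> (\<lambda>n. alg_inner (X n) (Y n)) \<longlonglongrightarrow> c)"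

text \<open>
  In terms of functionals, permuting the factors of a tensor amounts to permuting the arguments;
  \<open>sym_op_tensor\<close> below is the formula on elementary tensors.
\<close>

definition sym_op :: "nat \<Rightarrow> (bergman list \<Rightarrow> complex) \<Rightarrow> bergman list \<Rightarrow> complex" where
  "sym_op p \<phi> gs =
     (if length gs = p
      then (\<Sum>\<sigma> | \<sigma> permutes {..<p}. \<phi> (map (\<lambda>i. gs ! \<sigma> i) [0..<p])) / fact p else 0)"

definition sym_power :: "nat \<Rightarrow> (bergman list \<Rightarrow> complex) set" where
  "sym_power p = sym_op p ` tensor_power p"

definition sym_bergman :: "(nat \<Rightarrow> bergman list \<Rightarrow> complex) set" where
  "sym_bergman = {\<Phi>. (\<forall>p. \<Phi> p \<in> sym_power p) \<and> finite {p. \<Phi> p \<noteq> 0}}"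

definition sym_scale ::
  "complex \<Rightarrow> (nat \<Rightarrow> bergman list \<Rightarrow> complex) \<Rightarrow> nat \<Rightarrow> bergman list \<Rightarrow> complex" where
  "sym_scale c \<Phi> = (\<lambda>p gs. c * \<Phi> p gs)"

definition sym_embed :: "nat \<Rightarrow> (bergman list \<Rightarrow> complex) \<Rightarrow> nat \<Rightarrow> bergman list \<Rightarrow> complex" where
  "sym_embed p \<phi> = (\<lambda>q. if q = p then \<phi> else 0)"

text \<open>The generator \<open>\<one>\<close> of \<open>Sym\<^sup>0\<close> is the empty tensor, which has norm \<open>1\<close>.\<close>

definition sym_one :: "nat \<Rightarrow> bergman list \<Rightarrow> complex" where
  "sym_one = sym_embed 0 (tensor [])"

definition sym_inner ::
  "(nat \<Rightarrow> bergman list \<Rightarrow> complex) \<Rightarrow> (nat \<Rightarrow> bergman list \<Rightarrow> complex) \<Rightarrow> complex" where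
  "sym_inner \<Phi> \<Psi> = (\<Sum>p | \<Phi> p \<noteq> 0. tensor_inner p (\<Phi> p) (\<Psi> p))"

subsection \<open>Well-definedness\<close>

lemma bergman_measurable: "Rep_bergman f \<in> borel_measurable disk_measure"
proof -
  let ?f = "Rep_bergman f"
  have *: "?f holomorphic_on ball 0 1" "\<And>z. z \<notin> ball 0 1 \<Longrightarrow> ?f z = 0"
    using Rep_bergman[of f] by auto
  have "(\<lambda>z. indicator (ball 0 1) z *\<^sub>R ?f z) \<in> borel_measurable borel"
    by (rule borel_measurable_continuous_on_indicator)
      (use * holomorphic_on_imp_continuous_on in auto)
  moreover have "(\<lambda>z. indicator (ball 0 1) z *\<^sub>R ?f z) = ?f"
    using *(2) by (auto simp: fun_eq_iff indicator_def)
  ultimately show ?thesis by (simp add: disk_measure_def)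
qed

lemma bergman_integrable: "integrable disk_measure (\<lambda>z. cnj (Rep_bergman f z) * Rep_bergman g z)"
proof (rule Bochner_Integration.integrable_bound)
  show "integrable disk_measure (\<lambda>z. (cmod (Rep_bergman f z))\<^sup>2 + (cmod (Rep_bergman g z))\<^sup>2)"
    using Rep_bergman[of f] Rep_bergman[of g] by auto
  show "(\<lambda>z. cnj (Rep_bergman f z) * Rep_bergman g z) \<in> borel_measurable disk_measure"
    by (intro borel_measurable_times bergman_measurable
        borel_measurable_continuous_on[OF continuous_on_cnj[OF continuous_on_id]])
  have "a * b \<le> a\<^sup>2 + b\<^sup>2" for a b :: real
    using sum_squares_bound[of a b] zero_le_power2[of a] zero_le_power2[of b] by linarith
  then show "AE z in disk_measure. norm (cnj (Rep_bergman f z) * Rep_bergman g z)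
      \<le> norm ((cmod (Rep_bergman f z))\<^sup>2 + (cmod (Rep_bergman g z))\<^sup>2)"
    by (auto simp: norm_mult)
qed

lemma tensor_Nil [simp]: "tensor [] [] = 1"
  by (simp add: tensor_def)

lemma tensor_Cons [simp]: "tensor (f # fs) (g # gs) = bergman_inner g f * tensor fs gs"
  by (simp add: tensor_def prod.lessThan_Suc_shift del: prod.lessThan_Suc)

lemma bergman_inner_cnj: "cnj (bergman_inner f g) = bergman_inner g f"
proof -
  have "cnj (bergman_inner f g) = (LINT z|disk_measure. cnj (cnj (Rep_bergman f z) * Rep_bergman g z))"
    unfolding bergman_inner.rep_eq by (rule Bochner_Integration.integral_cnj[symmetric])
  then show ?thesis by (simp add: bergman_inner.rep_eq mult.commute)
qed

lemma tensor_cnj: "cnj (tensor fs gs) = tensor gs fs"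
  by (auto simp: tensor_def bergman_inner_cnj)

lemma tensor_nonneg:
  assumes "finite I" "\<And>i. i \<in> I \<Longrightarrow> length (x i) = n"
  shows "0 \<le> Re (\<Sum>i\<in>I. \<Sum>j\<in>I. cnj (c i) * c j * tensor (x j) (x i))"
  using assms(2)
proof (induction n arbitrary: x c)
  case 0
  then have "(\<Sum>i\<in>I. \<Sum>j\<in>I. cnj (c i) * c j * tensor (x j) (x i))
      = cnj (\<Sum>i\<in>I. c i) * (\<Sum>j\<in>I. c j)"
    by (simp add: sum_product)
  also have "\<dots> = of_real ((cmod (\<Sum>i\<in>I. c i))\<^sup>2)"
    by (simp only: complex_norm_square mult.commute)
  finally show ?case by simp
next
  case (Suc n)
  define a where "a i = Rep_bergman (hd (x i))" for i
  define b where "b i = tl (x i)" for i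
  have len: "length (b i) = n" if "i \<in> I" for i
    using Suc.prems[OF that] by (simp add: b_def)
  have "cnj (c i) * c j * tensor (x j) (x i) =
      (LINT z|disk_measure. cnj (c i) * c j * tensor (b j) (b i) * (cnj (a i z) * a j z))"
    if "i \<in> I" "j \<in> I" for i j
  proof -
    have "x i = hd (x i) # b i" "x j = hd (x j) # b j"
      using Suc.prems[OF that(1)] Suc.prems[OF that(2)] by (auto simp: b_def length_Suc_conv)
    then have "tensor (x j) (x i) = bergman_inner (hd (x i)) (hd (x j)) * tensor (b j) (b i)"
      by (metis tensor_Cons)
    then show ?thesis
      by (simp add: bergman_inner.rep_eq a_def)
  qed
  then have "(\<Sum>i\<in>I. \<Sum>j\<in>I. cnj (c i) * c j * tensor (x j) (x i)) =
      (\<Sum>i\<in>I. \<Sum>j\<in>I. LINT z|disk_measure.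
        cnj (c i) * c j * tensor (b j) (b i) * (cnj (a i z) * a j z))"
    by (intro sum.cong refl)
  also have "\<dots> = (LINT z|disk_measure. (\<Sum>i\<in>I. \<Sum>j\<in>I.
        cnj (c i) * c j * tensor (b j) (b i) * (cnj (a i z) * a j z)))"
    by (simp add: a_def bergman_integrable Bochner_Integration.integral_sum)
  also have "\<dots> = (LINT z|disk_measure. (\<Sum>i\<in>I. \<Sum>j\<in>I.
        cnj (c i * a i z) * (c j * a j z) * tensor (b j) (b i)))"
    by (simp add: mult_ac)
  finally have eq: "(\<Sum>i\<in>I. \<Sum>j\<in>I. cnj (c i) * c j * tensor (x j) (x i)) = \<dots>" .
  have int: "integrable disk_measure (\<lambda>z. \<Sum>i\<in>I. \<Sum>j\<in>I.
        cnj (c i * a i z) * (c j * a j z) * tensor (b j) (b i))"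
  proof -
    have "integrable disk_measure (\<lambda>z. \<Sum>i\<in>I. \<Sum>j\<in>I.
        cnj (c i) * c j * tensor (b j) (b i) * (cnj (a i z) * a j z))"
      by (simp add: a_def bergman_integrable)
    then show ?thesis by (simp add: mult_ac)
  qed
  show ?case
    unfolding eq integral_Re[OF int, symmetric]
    by (rule Bochner_Integration.integral_nonneg) (rule Suc.IH[OF len])
qed

definition alg_tensors :: "nat \<Rightarrow> (bergman list \<Rightarrow>\<^sub>0 complex) set" where
  "alg_tensors p = {u. \<forall>fs\<in>Poly_Mapping.keys u. length fs = p}"

lemma alg_tensors_diff: "u \<in> alg_tensors p \<Longrightarrow> v \<in> alg_tensors p \<Longrightarrow> u - v \<in> alg_tensors p"
  unfolding alg_tensors_def by (force simp: in_keys_iff lookup_minus)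

lemma alg_tensors_scale: "u \<in> alg_tensors p \<Longrightarrow> free_scale c u \<in> alg_tensors p"
  unfolding alg_tensors_def by (auto simp: in_keys_iff)

lemma tensor_sum_superset:
  assumes "finite A" "Poly_Mapping.keys u \<subseteq> A"
  shows "tensor_sum u gs = (\<Sum>fs\<in>A. Poly_Mapping.lookup u fs * tensor fs gs)"
  unfolding tensor_sum_def by (rule sum.mono_neutral_left) (use assms in \<open>auto simp: in_keys_iff\<close>)

lemma alg_inner_superset:
  assumes "finite A" "Poly_Mapping.keys u \<subseteq> A"
  shows "alg_inner u v = (\<Sum>gs\<in>A. cnj (Poly_Mapping.lookup u gs) * tensor_sum v gs)"
  unfolding alg_inner_def by (rule sum.mono_neutral_left) (use assms in \<open>auto simp: in_keys_iff\<close>)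

lemma tensor_sum_diff: "tensor_sum (u - v) gs = tensor_sum u gs - tensor_sum v gs"
proof -
  let ?A = "Poly_Mapping.keys u \<union> Poly_Mapping.keys v"
  have "Poly_Mapping.keys (u - v) \<subseteq> ?A" by (auto simp: in_keys_iff lookup_minus)
  then show ?thesis
    by (simp add: tensor_sum_superset[of ?A] lookup_minus left_diff_distrib sum_subtractf)
qed

lemma tensor_sum_scale: "tensor_sum (free_scale c u) gs = c * tensor_sum u gs"
proof -
  have "Poly_Mapping.keys (free_scale c u) \<subseteq> Poly_Mapping.keys u" by (auto simp: in_keys_iff)
  then show ?thesis
    by (simp add: tensor_sum_superset[of "Poly_Mapping.keys u"] sum_distrib_left mult.assoc)
qed

lemma alg_inner_diff_right: "alg_inner u (v - w) = alg_inner u v - alg_inner u w"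
  by (simp add: alg_inner_def tensor_sum_diff right_diff_distrib sum_subtractf)

lemma alg_inner_scale_right: "alg_inner u (free_scale c v) = c * alg_inner u v"
  by (simp add: alg_inner_def tensor_sum_scale sum_distrib_left mult_ac)

lemma alg_inner_cnj: "cnj (alg_inner u v) = alg_inner v u"
  unfolding alg_inner_def tensor_sum_def cnj_sum sum_distrib_left
  by (subst sum.swap) (simp add: tensor_cnj mult_ac)

lemma alg_inner_diff_left: "alg_inner (u - v) w = alg_inner u w - alg_inner v w"
  by (metis alg_inner_cnj alg_inner_diff_right complex_cnj_diff)

lemma alg_inner_scale_left: "alg_inner (free_scale c u) v = cnj c * alg_inner u v"
  by (metis alg_inner_cnj alg_inner_scale_right complex_cnj_mult)

lemma alg_inner_nonneg: "u \<in> alg_tensors p \<Longrightarrow> 0 \<le> Re (alg_inner u u)"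
  using tensor_nonneg[of "Poly_Mapping.keys u" "\<lambda>x. x" p "Poly_Mapping.lookup u"]
  by (simp add: alg_tensors_def alg_inner_def tensor_sum_def sum_distrib_left mult.assoc)

lemma alg_norm_nonneg: "u \<in> alg_tensors p \<Longrightarrow> 0 \<le> alg_norm u"
  by (simp add: alg_norm_def alg_inner_nonneg)

lemma alg_inner_self: "u \<in> alg_tensors p \<Longrightarrow> alg_inner u u = of_real ((alg_norm u)\<^sup>2)"
  using alg_inner_nonneg[of u p] arg_cong[OF alg_inner_cnj[of u u], of Im]
  by (simp add: alg_norm_def complex_eq_iff)

lemma alg_Cauchy_Schwarz:
  assumes u: "u \<in> alg_tensors p" and v: "v \<in> alg_tensors p"
  shows "cmod (alg_inner u v) \<le> alg_norm u * alg_norm v"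
proof -
  define s where "s = alg_inner v u"
  define S where "S = (cmod s)\<^sup>2"
  have ss: "s * cnj s = of_real S"
    unfolding S_def by (rule complex_norm_square[symmetric])
  have uv: "alg_inner u v = cnj s" by (simp add: s_def alg_inner_cnj)
  have quad: "0 \<le> (alg_norm u)\<^sup>2 - 2 * t * S + t\<^sup>2 * S * (alg_norm v)\<^sup>2" for t :: real
  proof -
    let ?a = "of_real t * s"
    let ?w = "u - free_scale ?a v"
    have "alg_inner ?w ?w = alg_inner u u - ?a * alg_inner u v
        - (cnj ?a * alg_inner v u - cnj ?a * ?a * alg_inner v v)"
      by (simp add: alg_inner_diff_left alg_inner_diff_right alg_inner_scale_left
          alg_inner_scale_right algebra_simps)
    also have "\<dots> = of_real ((alg_norm u)\<^sup>2) - of_real t * (s * cnj s)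
        - (of_real t * (s * cnj s) - of_real (t\<^sup>2) * (s * cnj s) * of_real ((alg_norm v)\<^sup>2))"
      by (simp add: uv alg_inner_self[OF u] alg_inner_self[OF v] s_def[symmetric] power2_eq_square
          mult_ac)
    also have "\<dots> = of_real ((alg_norm u)\<^sup>2 - 2 * t * S + t\<^sup>2 * S * (alg_norm v)\<^sup>2)"
      by (simp add: ss algebra_simps)
    finally show ?thesis
      using alg_inner_nonneg[OF alg_tensors_diff[OF u alg_tensors_scale[OF v]], of ?a] by simp
  qed
  have "S \<le> (alg_norm u)\<^sup>2 * (alg_norm v)\<^sup>2"
  proof (cases "alg_norm v = 0")
    case True
    have "S = 0"
    proof (rule ccontr)
      assume "S \<noteq> 0"
      then have "S > 0" by (simp add: S_def)
      then show False
        using quad[of "((alg_norm u)\<^sup>2 + 1) / (2 * S)"] True by simp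
    qed
    then show ?thesis by simp
  next
    case False
    then have "0 \<le> (alg_norm u)\<^sup>2 - S / (alg_norm v)\<^sup>2"
      using quad[of "1 / (alg_norm v)\<^sup>2"] by (simp add: power2_eq_square field_simps)
    then show ?thesis using False by (simp add: field_simps)
  qed
  then have "(cmod (alg_inner u v))\<^sup>2 \<le> (alg_norm u * alg_norm v)\<^sup>2"
    by (simp add: uv S_def power_mult_distrib)
  then show ?thesis
    by (rule power2_le_imp_le) (intro mult_nonneg_nonneg alg_norm_nonneg[OF u] alg_norm_nonneg[OF v])
qed

lemma alg_norm_diff_le:
  assumes u: "u \<in> alg_tensors p" and v: "v \<in> alg_tensors p"
  shows "alg_norm (u - v) \<le> alg_norm u + alg_norm v"
proof (rule power2_le_imp_le)
  have "Re (alg_inner (u - v) (u - v)) =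
      Re (alg_inner u u) + Re (alg_inner v v) - Re (alg_inner u v) - Re (alg_inner v u)"
    by (simp add: alg_inner_diff_left alg_inner_diff_right)
  moreover have "- Re (alg_inner u v) \<le> alg_norm u * alg_norm v"
    "- Re (alg_inner v u) \<le> alg_norm u * alg_norm v"
    using alg_Cauchy_Schwarz[OF u v] alg_Cauchy_Schwarz[OF v u]
      abs_Re_le_cmod[of "alg_inner u v"] abs_Re_le_cmod[of "alg_inner v u"]
    by (auto simp: mult.commute)
  ultimately show "(alg_norm (u - v))\<^sup>2 \<le> (alg_norm u + alg_norm v)\<^sup>2"
    using alg_inner_self[OF u] alg_inner_self[OF v] alg_inner_self[OF alg_tensors_diff[OF u v]]
    by (simp add: power2_sum)
qed (use alg_norm_nonneg[OF u] alg_norm_nonneg[OF v] in simp)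

lemma represents_tensors: "represents p X \<phi> \<Longrightarrow> X n \<in> alg_tensors p"
  by (auto simp: represents_def alg_tensors_def)

lemma represents_bounded:
  assumes X: "represents p X \<phi>"
  obtains M where "M > 0" "\<And>n. alg_norm (X n) \<le> M"
proof -
  note T = represents_tensors[OF X]
  obtain N where N: "\<And>m n. m \<ge> N \<Longrightarrow> n \<ge> N \<Longrightarrow> alg_norm (X m - X n) < 1"
    using X unfolding represents_def by (meson zero_less_one)
  define M where "M = 1 + alg_norm (X N) + (\<Sum>n<N. alg_norm (X n))"
  have pos: "alg_norm (X n) \<ge> 0" for n by (rule alg_norm_nonneg[OF T])
  have zero: "alg_norm (0 - u) = alg_norm u" for u
    by (simp add: alg_norm_def alg_inner_diff_left alg_inner_diff_right alg_inner_def[of 0]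
        tensor_sum_def[of 0] alg_inner_def[of _ 0] del: diff_0)
  have "alg_norm (X n) \<le> M" for n
  proof (cases "n < N")
    case True
    then have "alg_norm (X n) \<le> (\<Sum>n<N. alg_norm (X n))"
      by (intro member_le_sum) (auto simp: pos)
    then show ?thesis using pos[of N] by (simp add: M_def)
  next
    case False
    have "alg_norm (X n) = alg_norm ((X n - X N) - (0 - X N))" by simp
    also have "\<dots> \<le> alg_norm (X n - X N) + alg_norm (0 - X N)"
      by (intro alg_norm_diff_le[of _ p] alg_tensors_diff T) (simp add: alg_tensors_def)
    also have "\<dots> \<le> 1 + alg_norm (X N)"
      using N[of n N] False by (simp only: zero) simp
    also have "\<dots> \<le> M" by (simp add: M_def sum_nonneg pos)
    finally show ?thesis .
  qed
  moreover have "M > 0"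
    using pos[of N] sum_nonneg[of "{..<N}" "\<lambda>n. alg_norm (X n)", OF pos]
    unfolding M_def by linarith
  ultimately show ?thesis using that by blast
qed

lemma represents_diff:
  assumes X: "represents p X \<phi>" and Y: "represents p Y \<psi>"
  shows "represents p (\<lambda>n. X n - Y n) (\<lambda>gs. \<phi> gs - \<psi> gs)"
  unfolding represents_def
proof (intro conjI allI impI)
  fix n show "\<forall>fs\<in>Poly_Mapping.keys (X n - Y n). length fs = p"
    using alg_tensors_diff[OF represents_tensors[OF X] represents_tensors[OF Y]]
    by (simp add: alg_tensors_def)
next
  fix e :: real assume "e > 0"
  then have e: "e / 2 > 0" by simp
  obtain N1 where N1: "\<forall>m\<ge>N1. \<forall>n\<ge>N1. alg_norm (X m - X n) < e / 2"
    using X e unfolding represents_def by blast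
  obtain N2 where N2: "\<forall>m\<ge>N2. \<forall>n\<ge>N2. alg_norm (Y m - Y n) < e / 2"
    using Y e unfolding represents_def by blast
  show "\<exists>N. \<forall>m\<ge>N. \<forall>n\<ge>N. alg_norm (X m - Y m - (X n - Y n)) < e"
  proof (intro exI[of _ "max N1 N2"] allI impI)
    fix m n assume mn: "m \<ge> max N1 N2" "n \<ge> max N1 N2"
    have "alg_norm ((X m - X n) - (Y m - Y n)) \<le> alg_norm (X m - X n) + alg_norm (Y m - Y n)"
      by (intro alg_norm_diff_le[of _ p] alg_tensors_diff represents_tensors[OF X]
          represents_tensors[OF Y])
    also have "\<dots> < e"
      using N1[rule_format, of m n] N2[rule_format, of m n] mn by simp
    finally show "alg_norm (X m - Y m - (X n - Y n)) < e"
      by (simp add: algebra_simps)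
  qed
next
  fix gs show "(\<lambda>n. tensor_sum (X n - Y n) gs) \<longlonglongrightarrow> \<phi> gs - \<psi> gs"
    using X Y unfolding represents_def tensor_sum_diff by (intro tendsto_diff) auto
qed

lemma represents_zero_norm:
  assumes X: "represents p X (\<lambda>_. 0)"
  shows "(\<lambda>n. alg_norm (X n)) \<longlonglongrightarrow> 0"
proof -
  note T = represents_tensors[OF X]
  have "(\<lambda>n. (alg_norm (X n))\<^sup>2) \<longlonglongrightarrow> 0"
  proof (rule LIMSEQ_I)
    fix e :: real assume e: "e > 0"
    obtain M where M: "M > 0" "\<And>n. alg_norm (X n) \<le> M"
      using represents_bounded[OF X] by blast
    have "e / (2 * M) > 0" using e M by simp
    then obtain N where N: "\<forall>m\<ge>N. \<forall>n\<ge>N. alg_norm (X m - X n) < e / (2 * M)"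
      using X unfolding represents_def by blast
    have "(\<lambda>n. alg_inner (X N) (X n)) \<longlonglongrightarrow>
        (\<Sum>gs\<in>Poly_Mapping.keys (X N). cnj (Poly_Mapping.lookup (X N) gs) * 0)"
      using X unfolding represents_def alg_inner_def by (intro tendsto_sum tendsto_mult) auto
    then have "(\<lambda>n. alg_inner (X N) (X n)) \<longlonglongrightarrow> 0" by simp
    from LIMSEQ_D[OF this, of "e / 2"] e
    obtain N' where N': "\<And>n. n \<ge> N' \<Longrightarrow> cmod (alg_inner (X N) (X n)) < e / 2" by auto
    show "\<exists>no. \<forall>n\<ge>no. norm ((alg_norm (X n))\<^sup>2 - 0) < e"
    proof (intro exI[of _ "max N N'"] allI impI)
      fix n assume n: "n \<ge> max N N'"
      have "cmod (alg_inner (X n - X N) (X n)) \<le> alg_norm (X n - X N) * alg_norm (X n)"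
        by (intro alg_Cauchy_Schwarz[of _ p] alg_tensors_diff T)
      also have "\<dots> \<le> e / (2 * M) * M"
        using N[rule_format, of n N] n M
        by (intro mult_mono) (auto intro: alg_norm_nonneg[OF T] less_imp_le simp: e less_imp_le[OF e])
      also have "\<dots> = e / 2" using M by simp
      finally have "cmod (alg_inner (X n - X N) (X n)) \<le> e / 2" .
      moreover have "of_real ((alg_norm (X n))\<^sup>2) =
          alg_inner (X n - X N) (X n) + alg_inner (X N) (X n)"
        by (simp only: alg_inner_diff_left alg_inner_self[OF T, symmetric]) simp
      then have "cmod (of_real ((alg_norm (X n))\<^sup>2)) \<le>
          cmod (alg_inner (X n - X N) (X n)) + cmod (alg_inner (X N) (X n))"
        by (metis norm_triangle_ineq)
      ultimately show "norm ((alg_norm (X n))\<^sup>2 - 0) < e"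
        using N'[of n] n by (simp add: norm_of_real del: of_real_power)
    qed
  qed
  from tendsto_real_sqrt[OF this] show ?thesis
    using alg_norm_nonneg[OF T] by simp
qed

lemma alg_inner_tendsto_zero:
  assumes u: "\<And>n. u n \<in> alg_tensors p" and v: "\<And>n. v n \<in> alg_tensors p"
    and lim: "(\<lambda>n. alg_norm (u n)) \<longlonglongrightarrow> 0" and bd: "\<And>n. alg_norm (v n) \<le> M"
  shows "(\<lambda>n. alg_inner (u n) (v n)) \<longlonglongrightarrow> 0"
proof (rule Lim_null_comparison)
  show "\<forall>\<^sub>F n in sequentially. norm (alg_inner (u n) (v n)) \<le> alg_norm (u n) * M"
    by (intro always_eventually allI order.trans[OF alg_Cauchy_Schwarz[OF u v]]
        mult_left_mono bd alg_norm_nonneg[OF u])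
  show "(\<lambda>n. alg_norm (u n) * M) \<longlonglongrightarrow> 0"
    using tendsto_mult_right[OF lim, of M] by simp
qed

lemma represents_unique_limit:
  assumes X: "represents p X \<phi>" and X': "represents p X' \<phi>"
    and Y: "represents p Y \<psi>" and Y': "represents p Y' \<psi>"
  shows "(\<lambda>n. alg_inner (X n) (Y n) - alg_inner (X' n) (Y' n)) \<longlonglongrightarrow> 0"
proof -
  note T = represents_tensors
  have D: "represents p (\<lambda>n. X n - X' n) (\<lambda>_. 0)" "represents p (\<lambda>n. Y n - Y' n) (\<lambda>_. 0)"
    using represents_diff[OF X X'] represents_diff[OF Y Y'] by simp_all
  obtain M where M: "\<And>n. alg_norm (Y n) \<le> M" using represents_bounded[OF Y] by blast
  obtain M' where M': "\<And>n. alg_norm (X' n) \<le> M'" using represents_bounded[OF X'] by blast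
  have "(\<lambda>n. alg_inner (X n - X' n) (Y n)) \<longlonglongrightarrow> 0"
    by (rule alg_inner_tendsto_zero[OF T[OF D(1)] T[OF Y] represents_zero_norm[OF D(1)] M])
  moreover have "(\<lambda>n. alg_inner (Y n - Y' n) (X' n)) \<longlonglongrightarrow> 0"
    by (rule alg_inner_tendsto_zero[OF T[OF D(2)] T[OF X'] represents_zero_norm[OF D(2)] M'])
  then have "(\<lambda>n. cnj (alg_inner (Y n - Y' n) (X' n))) \<longlonglongrightarrow> cnj 0"
    by (rule tendsto_cnj)
  then have "(\<lambda>n. alg_inner (X' n) (Y n - Y' n)) \<longlonglongrightarrow> 0" by (simp add: alg_inner_cnj)
  ultimately have "(\<lambda>n. alg_inner (X n - X' n) (Y n) + alg_inner (X' n) (Y n - Y' n))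
      \<longlonglongrightarrow> 0 + 0"
    by (rule tendsto_add)
  then show ?thesis by (simp add: alg_inner_diff_left alg_inner_diff_right)
qed

lemma represents_convergent:
  assumes X: "represents p X \<phi>" and Y: "represents p Y \<psi>"
  shows "convergent (\<lambda>n. alg_inner (X n) (Y n))"
proof (rule Cauchy_convergent, rule CauchyI)
  fix e :: real assume e: "e > 0"
  note TX = represents_tensors[OF X] and TY = represents_tensors[OF Y]
  obtain M where M: "M > 0" "\<And>n. alg_norm (X n) \<le> M" using represents_bounded[OF X] by blast
  obtain M' where M': "M' > 0" "\<And>n. alg_norm (Y n) \<le> M'" using represents_bounded[OF Y] by blast
  have "e / (2 * M') > 0" "e / (2 * M) > 0" using e M M' by simp_all
  then obtain N1 N2 where N1: "\<forall>m\<ge>N1. \<forall>n\<ge>N1. alg_norm (X m - X n) < e / (2 * M')"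
    and N2: "\<forall>m\<ge>N2. \<forall>n\<ge>N2. alg_norm (Y m - Y n) < e / (2 * M)"
    using X Y unfolding represents_def by metis
  show "\<exists>K. \<forall>m\<ge>K. \<forall>n\<ge>K. norm (alg_inner (X m) (Y m) - alg_inner (X n) (Y n)) < e"
  proof (intro exI[of _ "max N1 N2"] allI impI)
    fix m n assume mn: "m \<ge> max N1 N2" "n \<ge> max N1 N2"
    have "alg_norm (X m - X n) * alg_norm (Y m) \<le> alg_norm (X m - X n) * M'"
      by (intro mult_left_mono M' alg_norm_nonneg[of _ p] alg_tensors_diff TX)
    also have "\<dots> < e / (2 * M') * M'"
      using N1 mn M' by (intro mult_strict_right_mono) auto
    finally have 1: "alg_norm (X m - X n) * alg_norm (Y m) < e / 2" using M' by simp
    have "alg_norm (X n) * alg_norm (Y m - Y n) \<le> M * alg_norm (Y m - Y n)"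
      by (intro mult_right_mono M alg_norm_nonneg[of _ p] alg_tensors_diff TY)
    also have "\<dots> < M * (e / (2 * M))"
      using N2 mn M by (intro mult_strict_left_mono) auto
    finally have 2: "alg_norm (X n) * alg_norm (Y m - Y n) < e / 2" using M by simp
    have "alg_inner (X m) (Y m) - alg_inner (X n) (Y n) =
        alg_inner (X m - X n) (Y m) + alg_inner (X n) (Y m - Y n)"
      by (simp add: alg_inner_diff_left alg_inner_diff_right)
    then have "norm (alg_inner (X m) (Y m) - alg_inner (X n) (Y n)) \<le>
        norm (alg_inner (X m - X n) (Y m)) + norm (alg_inner (X n) (Y m - Y n))"
      by (metis norm_triangle_ineq)
    also have "\<dots> \<le> alg_norm (X m - X n) * alg_norm (Y m) + alg_norm (X n) * alg_norm (Y m - Y n)"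
      by (intro add_mono alg_Cauchy_Schwarz[of _ p] alg_tensors_diff TX TY)
    finally show "norm (alg_inner (X m) (Y m) - alg_inner (X n) (Y n)) < e"
      using 1 2 by simp
  qed
qed

lemma tensor_inner_limit:
  assumes X: "represents p X \<phi>" and Y: "represents p Y \<psi>"
  shows "(\<lambda>n. alg_inner (X n) (Y n)) \<longlonglongrightarrow> tensor_inner p \<phi> \<psi>"
proof -
  obtain c where c: "(\<lambda>n. alg_inner (X n) (Y n)) \<longlonglongrightarrow> c"
    using represents_convergent[OF X Y] by (auto simp: convergent_def)
  have "tensor_inner p \<phi> \<psi> = c"
    unfolding tensor_inner_def
  proof (rule the_equality)
    show "\<exists>X Y. represents p X \<phi> \<and> represents p Y \<psi> \<and> (\<lambda>n. alg_inner (X n) (Y n)) \<longlonglongrightarrow> c"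
      using X Y c by blast
  next
    fix d assume "\<exists>X Y. represents p X \<phi> \<and> represents p Y \<psi> \<and> (\<lambda>n. alg_inner (X n) (Y n)) \<longlonglongrightarrow> d"
    then obtain X' Y' where *: "represents p X' \<phi>" "represents p Y' \<psi>"
      "(\<lambda>n. alg_inner (X' n) (Y' n)) \<longlonglongrightarrow> d" by blast
    have "(\<lambda>n. alg_inner (X' n) (Y' n) - alg_inner (X n) (Y n)) \<longlonglongrightarrow> d - c"
      by (rule tendsto_diff[OF *(3) c])
    with represents_unique_limit[OF *(1) X *(2) Y] have "d - c = 0"
      using LIMSEQ_unique by blast
    then show "d = c" by simp
  qed
  with c show ?thesis by simp
qed

lemma represents_const: "u \<in> alg_tensors p \<Longrightarrow> represents p (\<lambda>_. u) (tensor_sum u)"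
  by (auto simp: represents_def alg_tensors_def alg_norm_def alg_inner_def)

lemma tensor_inner_tensor_sum:
  assumes "u \<in> alg_tensors p" "v \<in> alg_tensors p"
  shows "tensor_inner p (tensor_sum u) (tensor_sum v) = alg_inner u v"
  using tensor_inner_limit[OF represents_const[OF assms(1)] represents_const[OF assms(2)]]
    LIMSEQ_unique tendsto_const by blast

lemma tensor_sum_single [simp]: "tensor_sum (Poly_Mapping.single fs c) gs = c * tensor fs gs"
  by (auto simp: tensor_sum_def)

lemma single_alg_tensors: "length fs = p \<Longrightarrow> Poly_Mapping.single fs c \<in> alg_tensors p"
  by (auto simp: alg_tensors_def)

lemma tensor_in_tensor_power: "tensor fs \<in> tensor_power (length fs)"
proof -
  have "tensor_sum (Poly_Mapping.single fs 1) = tensor fs" by (simp add: fun_eq_iff)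
  then show ?thesis
    using represents_const[OF single_alg_tensors[OF refl], of fs 1]
    unfolding tensor_power_def by auto
qed

lemma tensor_inner_tensor:
  assumes "length fs = p" "length gs = p"
  shows "tensor_inner p (tensor fs) (tensor gs) = (\<Prod>i<p. bergman_inner (fs ! i) (gs ! i))"
proof -
  have "tensor_sum (Poly_Mapping.single xs 1) = tensor xs" for xs by (simp add: fun_eq_iff)
  then have "tensor_inner p (tensor fs) (tensor gs) =
      alg_inner (Poly_Mapping.single fs 1) (Poly_Mapping.single gs 1)"
    using tensor_inner_tensor_sum[OF single_alg_tensors[of fs p 1] single_alg_tensors[of gs p 1]]
      assms by simp
  also have "\<dots> = tensor gs fs" by (simp add: alg_inner_def)
  finally show ?thesis using assms by (simp add: tensor_def)
qed

lemma sym_op_tensor: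
  assumes "length fs = p"
  shows "sym_op p (tensor fs) gs =
    (\<Sum>\<sigma> | \<sigma> permutes {..<p}. tensor (map (\<lambda>i. fs ! \<sigma> i) [0..<p]) gs) / fact p"
proof (cases "length gs = p")
  case True
  have *: "tensor fs (map (\<lambda>i. gs ! inv \<sigma> i) [0..<p]) = tensor (map (\<lambda>i. fs ! \<sigma> i) [0..<p]) gs"
    if \<sigma>: "\<sigma> permutes {..<p}" for \<sigma>
  proof -
    have "(\<Prod>i<p. bergman_inner (gs ! inv \<sigma> i) (fs ! i)) =
        (\<Prod>i<p. bergman_inner (gs ! i) (fs ! \<sigma> i))"
      by (subst prod.permute[OF \<sigma>]) (simp add: permutes_inverses[OF \<sigma>] o_def)
    then show ?thesis using assms True by (simp add: tensor_def)
  qed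
  have "(\<Sum>\<sigma> | \<sigma> permutes {..<p}. tensor fs (map (\<lambda>i. gs ! \<sigma> i) [0..<p])) =
      (\<Sum>\<sigma> | \<sigma> permutes {..<p}. tensor fs (map (\<lambda>i. gs ! inv \<sigma> i) [0..<p]))"
    by (rule sum_permutations_inverse)
  then show ?thesis using True * by (simp add: sym_op_def)
next
  case False
  then show ?thesis by (simp add: sym_op_def tensor_def)
qed


section \<open>The Heisenberg module \<open>M(0)\<close>\<close>

text \<open>
  \<open>HGen n\<close> stands for \<open>h \<otimes> t\<^sup>n\<close> and \<open>HCen\<close> for \<open>c\<close>.  Words in these letters span the tensor algebra of
  the Heisenberg Lie algebra.  The induced module is its quotient by the left ideal generated by
  the relations \<open>x y - y x = [x, y]\<close> of the enveloping algebra, taken two-sidedly, together with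
  \<open>h \<otimes> t\<^sup>n\<close> for \<open>n \<ge> 0\<close> and \<open>c - 1\<close>, which annihilate the vacuum sitting at the right end of a word.
\<close>

datatype heis_gen = HGen int | HCen

type_synonym heis_free = "heis_gen list \<Rightarrow>\<^sub>0 complex"

abbreviation word :: "heis_gen list \<Rightarrow> heis_free" where
  "word w \<equiv> Poly_Mapping.single w 1"

inductive_set heis_relations :: "heis_free set" where
  comm_HGen: "word (u @ [HGen m, HGen n] @ v) - word (u @ [HGen n, HGen m] @ v)
      - (if m + n = 0 then Poly_Mapping.single (u @ [HCen] @ v) (of_int m) else 0) \<in> heis_relations"
| comm_HCen: "word (u @ [HCen, x] @ v) - word (u @ [x, HCen] @ v) \<in> heis_relations"
| vac_HGen: "n \<ge> 0 \<Longrightarrow> word (u @ [HGen n]) \<in> heis_relations"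
| vac_HCen: "word (u @ [HCen]) - word u \<in> heis_relations"

definition heis_null :: "heis_free set" where
  "heis_null = free.span heis_relations"

lemma heis_null_intros:
  "0 \<in> heis_null"
  "a \<in> heis_null \<Longrightarrow> b \<in> heis_null \<Longrightarrow> a + b \<in> heis_null"
  "a \<in> heis_null \<Longrightarrow> b \<in> heis_null \<Longrightarrow> a - b \<in> heis_null"
  "a \<in> heis_null \<Longrightarrow> - a \<in> heis_null"
  "a \<in> heis_null \<Longrightarrow> free_scale c a \<in> heis_null"
  "a \<in> heis_relations \<Longrightarrow> a \<in> heis_null"
  by (simp_all add: heis_null_def free.span_zero free.span_add free.span_diff
      free.span_neg free.span_scale free.span_base)

quotient_type fock = heis_free / "\<lambda>a b. a - b \<in> heis_null"
proof (rule equivpI)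
  show "reflp (\<lambda>a b. a - b \<in> heis_null)"
    by (rule reflpI) (simp add: heis_null_intros)
  show "symp (\<lambda>a b. a - b \<in> heis_null)"
    by (rule sympI) (metis heis_null_intros(4) minus_diff_eq)
  show "transp (\<lambda>a b. a - b \<in> heis_null)"
  proof (rule transpI)
    fix a b c assume "a - b \<in> heis_null" "b - c \<in> heis_null"
    from heis_null_intros(2)[OF this] show "a - c \<in> heis_null" by simp
  qed
qed

instantiation fock :: ab_group_add
begin

lift_definition zero_fock :: fock is 0 .

lift_definition plus_fock :: "fock \<Rightarrow> fock \<Rightarrow> fock" is "(+)"
proof -
  fix a b c d :: heis_free assume "a - b \<in> heis_null" "c - d \<in> heis_null"
  from heis_null_intros(2)[OF this] show "a + c - (b + d) \<in> heis_null"
    by (simp add: algebra_simps)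
qed

lift_definition uminus_fock :: "fock \<Rightarrow> fock" is uminus
proof -
  fix a b :: heis_free assume "a - b \<in> heis_null"
  from heis_null_intros(4)[OF this] show "- a - - b \<in> heis_null"
    by (simp add: algebra_simps)
qed

lift_definition minus_fock :: "fock \<Rightarrow> fock \<Rightarrow> fock" is "(-)"
proof -
  fix a b c d :: heis_free assume "a - b \<in> heis_null" "c - d \<in> heis_null"
  from heis_null_intros(3)[OF this] show "a - c - (b - d) \<in> heis_null"
    by (simp add: algebra_simps)
qed

instance
  by standard (transfer, simp add: heis_null_intros algebra_simps)+

end

lift_definition fock_scale :: "complex \<Rightarrow> fock \<Rightarrow> fock" is free_scale
  by (simp add: heis_null_intros flip: free.scale_right_diff_distrib)

interpretation fock: vector_space fock_scale
  by standard (transfer, simp add: heis_null_intros algebra_simps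
      free.scale_right_distrib free.scale_left_distrib)+

lift_definition prepend :: "heis_gen \<Rightarrow> heis_free \<Rightarrow> heis_free"
  is "\<lambda>x u w. case w of [] \<Rightarrow> 0 | y # v \<Rightarrow> (if y = x then u v else 0)"
proof -
  fix x :: heis_gen and u :: "heis_gen list \<Rightarrow> complex"
  assume "finite {v. u v \<noteq> 0}"
  moreover have "{w. (case w of [] \<Rightarrow> 0 | y # v \<Rightarrow> if y = x then u v else 0) \<noteq> 0}
      \<subseteq> (#) x ` {v. u v \<noteq> 0}" (is "?L \<subseteq> ?R")
  proof
    fix w assume "w \<in> ?L"
    then show "w \<in> ?R" by (cases w) (auto split: if_splits)
  qed
  ultimately show "finite {w. (case w of [] \<Rightarrow> 0 | y # v \<Rightarrow> if y = x then u v else 0) \<noteq> 0}"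
    by (meson finite_imageI finite_subset)
qed

lemma prepend_add: "prepend x (a + b) = prepend x a + prepend x b"
  by transfer (auto simp: fun_eq_iff split: list.splits)

lemma prepend_diff: "prepend x (a - b) = prepend x a - prepend x b"
  by transfer (auto simp: fun_eq_iff split: list.splits)

lemma prepend_single: "prepend x (Poly_Mapping.single w c) = Poly_Mapping.single (x # w) c"
  by transfer (auto simp: fun_eq_iff when_def split: list.splits)

lemma prepend_zero: "prepend x 0 = 0"
  by transfer (auto simp: fun_eq_iff split: list.splits)

lemma prepend_scale: "prepend x (free_scale c a) = free_scale c (prepend x a)"
  by (rule poly_mapping_eqI) (auto simp: prepend.rep_eq split: list.splits)

lemma prepend_relations: "a \<in> heis_relations \<Longrightarrow> prepend x a \<in> heis_relations"
proof (induction rule: heis_relations.induct)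
  case (comm_HGen u m n v)
  show ?case
    using heis_relations.comm_HGen[of "x # u" m n v]
    by (simp add: prepend_diff prepend_single prepend_zero if_distrib[of "prepend x"] cong: if_cong)
next
  case (comm_HCen u y v)
  show ?case
    using heis_relations.comm_HCen[of "x # u" y v] by (simp add: prepend_diff prepend_single)
next
  case (vac_HGen n u)
  then show ?case
    using heis_relations.vac_HGen[of n "x # u"] by (simp add: prepend_single)
next
  case (vac_HCen u)
  show ?case
    using heis_relations.vac_HCen[of "x # u"] by (simp add: prepend_diff prepend_single)
qed

lemma prepend_null: "a \<in> heis_null \<Longrightarrow> prepend x a \<in> heis_null"
  unfolding heis_null_def
proof (induction rule: free.span_induct_alt)
  case base
  show ?case by (simp add: prepend_zero free.span_zero)
next
  case (step c a b)
  then show ?case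
    by (simp add: prepend_add prepend_scale free.span_add free.span_scale free.span_base
        prepend_relations)
qed

lift_definition heis_act :: "heis_gen \<Rightarrow> fock \<Rightarrow> fock" is prepend
  by (simp add: prepend_null flip: prepend_diff)

abbreviation h :: "int \<Rightarrow> fock \<Rightarrow> fock" where
  "h n \<equiv> heis_act (HGen n)"

lift_definition vac :: fock is "word []" .


section \<open>Vertex algebras and the invariant form\<close>

text \<open>
  \<open>mode a n b\<close> is \<open>a(n)b\<close>, where \<open>Y(a, z) = \<Sum>\<^sub>n a(n) z\<^sup>-\<^sup>n\<^sup>-\<^sup>1\<close>.  All sums in the Borcherds identity
  have finite support by truncation.
\<close>

locale vertex_algebra = vector_space scale
  for scale :: "complex \<Rightarrow> 'v::ab_group_add \<Rightarrow> 'v" +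
  fixes mode :: "'v \<Rightarrow> int \<Rightarrow> 'v \<Rightarrow> 'v" and vacuum :: 'v
  assumes mode_linear_left: "Vector_Spaces.linear scale scale (\<lambda>a. mode a n b)"
    and mode_linear_right: "Vector_Spaces.linear scale scale (\<lambda>b. mode a n b)"
    and truncation: "\<exists>N. \<forall>n\<ge>N. mode a n b = 0"
    and vacuum_mode: "mode vacuum n b = (if n = - 1 then b else 0)"
    and creation: "mode a (- 1) vacuum = a" "n \<ge> 0 \<Longrightarrow> mode a n vacuum = 0"
    and borcherds:
      "Sum_any (\<lambda>i::nat. scale (of_int p gchoose i) (mode (mode a (r + int i) b) (p + q - int i) c)) =
       Sum_any (\<lambda>i::nat. scale ((- 1) ^ i * (of_int r gchoose i))
         (mode a (p + r - int i) (mode b (q + int i) c)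
          - scale ((- 1) powi r) (mode b (q + r - int i) (mode a (p + int i) c))))"

definition heisenberg_vertex_algebra :: "(fock \<Rightarrow> int \<Rightarrow> fock \<Rightarrow> fock) \<Rightarrow> bool" where
  "heisenberg_vertex_algebra Y \<longleftrightarrow>
     vertex_algebra fock_scale Y vac \<and> (\<forall>n. Y (h (- 1) vac) n = h n)"

definition vir :: "(fock \<Rightarrow> int \<Rightarrow> fock \<Rightarrow> fock) \<Rightarrow> int \<Rightarrow> fock \<Rightarrow> fock" where
  "vir Y n = Y (fock_scale (1 / 2) (h (- 1) (h (- 1) vac))) (n + 1)"

text \<open>
  For \<open>a\<close> with \<open>L(0)a = w a\<close> one has \<open>(-z\<^sup>-\<^sup>2)\<^bsup>L(0)\<^esup>a = (-1)\<^sup>w z\<^sup>-\<^sup>2\<^sup>w a\<close>, and the coefficient of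
  \<open>z\<^sup>-\<^sup>j\<^sup>-\<^sup>1\<close> in \<open>Y(e\<^bsup>zL(1)\<^esup>(-z\<^sup>-\<^sup>2)\<^bsup>L(0)\<^esup>a, z\<^sup>-\<^sup>1)
  = \<Sum>\<^sub>k \<Sum>\<^sub>m (-1)\<^sup>w / k! (L(1)\<^sup>ka)(m) z\<^bsup>m+1+k-2w\<^esup>\<close> is \<open>opposite_mode Y w a j\<close>.
  Such \<open>a\<close> span \<open>M(0)\<close>, so it suffices to require invariance for them; the sum over \<open>k\<close> is
  finite because \<open>L(1)\<close> lowers the weight \<open>w \<ge> 0\<close>.
\<close>

definition opposite_mode ::
  "(fock \<Rightarrow> int \<Rightarrow> fock \<Rightarrow> fock) \<Rightarrow> nat \<Rightarrow> fock \<Rightarrow> int \<Rightarrow> fock \<Rightarrow> fock" where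
  "opposite_mode Y w a j b =
     Sum_any (\<lambda>k::nat. fock_scale ((- 1) ^ w / fact k)
       (Y ((vir Y 1 ^^ k) a) (2 * int w - int k - j - 2) b))"

definition normalized_invariant_form ::
  "(fock \<Rightarrow> int \<Rightarrow> fock \<Rightarrow> fock) \<Rightarrow> (fock \<Rightarrow> fock \<Rightarrow> complex) \<Rightarrow> bool" where
  "normalized_invariant_form Y B \<longleftrightarrow>
     (\<forall>b. Vector_Spaces.linear fock_scale (*) (\<lambda>a. B a b)) \<and>
     (\<forall>a b. B a b = B b a) \<and>
     B vac vac = 1 \<and>
     (\<forall>w a j b c. vir Y 0 a = fock_scale (of_nat w) a \<longrightarrow>
        B (Y a j b) c = B b (opposite_mode Y w a j c))"

definition theta_map :: "(fock \<Rightarrow> fock) \<Rightarrow> bool" where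
  "theta_map \<theta> \<longleftrightarrow>
     (\<forall>a b. \<theta> (a + b) = \<theta> a + \<theta> b) \<and>
     (\<forall>c a. \<theta> (fock_scale c a) = fock_scale (cnj c) (\<theta> a)) \<and>
     (\<forall>ks::nat list. (\<forall>k\<in>set ks. k \<ge> 1) \<longrightarrow>
        \<theta> (foldr (\<lambda>k. h (- int k)) ks vac) =
        fock_scale ((- 1) ^ length ks) (foldr (\<lambda>k. h (- int k)) ks vac))"


section \<open>The map \<open>\<Psi>\<close>\<close>

text \<open>
  A list \<open>[(i\<^sub>1, k\<^sub>1), \<dots>, (i\<^sub>n, k\<^sub>n)]\<close> encodes the monomial
  \<open>h(-i\<^sub>1-1)\<^bsup>k\<^sub>1\<^esup> \<cdots> h(-i\<^sub>n-1)\<^bsup>k\<^sub>n\<^esup>\<one>\<close> and the tensor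
  \<open>h\<^bsub>i\<^sub>1\<^esub>\<^bsup>\<otimes>k\<^sub>1\<^esup> \<otimes> \<cdots> \<otimes> h\<^bsub>i\<^sub>n\<^esub>\<^bsup>\<otimes>k\<^sub>n\<^esup>\<close>.
\<close>

definition fock_monomial :: "(nat \<times> nat) list \<Rightarrow> fock" where
  "fock_monomial iks = foldr (\<lambda>(i, k). h (- int i - 1) ^^ k) iks vac"

definition h_tensor :: "(nat \<times> nat) list \<Rightarrow> bergman list \<Rightarrow> complex" where
  "h_tensor iks = tensor (concat (map (\<lambda>(i, k). replicate k (h_fun i)) iks))"

definition Psi_map :: "(fock \<Rightarrow> nat \<Rightarrow> bergman list \<Rightarrow> complex) \<Rightarrow> bool" where
  "Psi_map \<Psi> \<longleftrightarrow>
     Vector_Spaces.linear fock_scale sym_scale \<Psi> \<and>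
     \<Psi> vac = sym_one \<and>
     (\<forall>iks. iks \<noteq> [] \<and> sorted_wrt (\<lambda>x y. fst x > fst y) iks \<and> (\<forall>(i, k)\<in>set iks. k \<ge> 1) \<longrightarrow>
        (let p = sum_list (map snd iks) in
         \<Psi> (fock_monomial iks) =
         sym_scale (of_real (sqrt (fact p))) (sym_embed p (sym_op p (h_tensor iks)))))"

end

theory Submission
  imports Defs
begin

text \<open>
  Both inner products, evaluated on monomials, are the same permanent.

  On the side of the Bergman space, rotation invariance and scaling of the area measure show that the
  functions \<open>h\<^bsub>j\<^esub>\<close> are orthogonal with \<open>(h\<^bsub>j\<^esub>, h\<^bsub>j\<^esub>) = j + 1\<close> (\<open>bergman_inner_h_fun\<close>).  Symmetrisation is a
  self-adjoint projection, so the inner product of two symmetrised elementary tensors of degree \<open>p\<close> is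
  \<open>1 / p!\<close> times the permanent of the matrix of inner products of their factors
  (\<open>tensor_inner_sym_op\<close>); the two factors \<open>\<surd>(p!)\<close> in \<open>\<Psi>\<close> remove the \<open>1 / p!\<close>.

  On the side of \<open>M(0)\<close>, the Borcherds identity shows that \<open>h(-1)\<one>\<close> has weight one and is annihilated
  by \<open>L(1)\<close>.  Invariance of the form therefore makes \<open>-h(-n)\<close> the adjoint of \<open>h(n)\<close>
  (\<open>invariant_form_h_adjoint\<close>), and \<open>\<theta>\<close> absorbs the sign.  Moving creation operators from the first
  argument to annihilation operators on the second and commuting them to the vacuum expands the form
  recursively (\<open>form_creation_product_add_mset\<close>).  This recursion is the Laplace expansion of the
  permanent with entries \<open>\<delta>\<^bsub>ij\<^esub> (i + 1)\<close> (\<open>pairing_eq_sum_permutations\<close>).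

  The monomials span \<open>M(0)\<close> (\<open>fock_induct\<close>), and both forms are sesquilinear.
\<close>

section \<open>Inner products of monomials on the disk\<close>

text \<open>
  Boxes correspond to boxes of the same side lengths.  This identification turns a rotation of the
  plane into an orthogonal map of \<open>real ^ 2\<close>, whose invariance property then carries over.
\<close>

lemma lborel_complex_eq_distr_real2:
  "lborel = distr (lborel :: (real^2) measure) borel (\<lambda>v. Complex (v $ 1) (v $ 2))"
proof (rule lborel_eqI)
  let ?g = "\<lambda>v::real^2. Complex (v $ 1) (v $ 2)"
  have g: "?g \<in> borel_measurable borel"
    by (intro borel_measurable_continuous_onI) (simp add: Complex_eq, intro continuous_intros)
  fix l u :: complex
  assume le: "\<And>b. b \<in> Basis \<Longrightarrow> l \<bullet> b \<le> u \<bullet> b"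
  then have le': "Re l \<le> Re u" "Im l \<le> Im u"
    using le[of 1] le[of \<i>] by (simp_all add: Basis_complex_def inner_complex_def)
  let ?v = "\<lambda>z. vector [Re z, Im z] :: real^2"
  have "?g -` box l u = box (?v l) (?v u)"
    by (auto simp: box_def Basis_complex_def Basis_vec_def inner_axis forall_2 axis_eq_axis)
  then have "emeasure (distr lborel borel ?g) (box l u) = emeasure lborel (box (?v l) (?v u))"
    using g by (subst emeasure_distr) auto
  also have "\<dots> = ennreal (\<Prod>b\<in>Basis. (?v u - ?v l) \<bullet> b)"
  proof (rule emeasure_lborel_box)
    have "?v l $ i \<le> ?v u $ i" for i
      using le' exhaust_2[of i] by auto
    then show "?v l \<bullet> b \<le> ?v u \<bullet> b" if "b \<in> Basis" for b
      using that by (auto simp: Basis_vec_def inner_axis)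
  qed
  also have "(\<Prod>b\<in>Basis. (?v u - ?v l) \<bullet> b) = (\<Prod>b\<in>Basis. (u - l) \<bullet> b)"
  proof -
    have B: "(Basis :: (real^2) set) = {axis 1 1, axis 2 1}"
      by (auto simp: Basis_vec_def) (metis exhaust_2)
    show ?thesis
      by (simp add: B Basis_complex_def inner_axis axis_eq_axis)
  qed
  finally show "emeasure (distr lborel borel ?g) (box l u) = ennreal (\<Prod>b\<in>Basis. (u - l) \<bullet> b)"
    by simp
qed simp

lemma lborel_distr_rotation:
  fixes w :: complex
  assumes w: "cmod w = 1"
  shows "distr lborel borel ((*) w) = lborel"
proof (rule lborel_eqI[symmetric])
  define g :: "real^2 \<Rightarrow> complex" where "g x = Complex (x $ 1) (x $ 2)" for x
  define v :: "complex \<Rightarrow> real^2" where "v z = vector [Re z, Im z]" for z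
  define f where "f x = v (inverse w * g x)" for x
  have vg: "v (g x) = x" and gv [simp]: "g (v z) = z" for x z
    by (auto simp: v_def g_def vec_eq_iff forall_2)
  have w0: "w \<noteq> 0" using w by auto
  have g: "g \<in> borel_measurable borel"
    unfolding g_def Complex_eq by (intro borel_measurable_continuous_onI continuous_intros)
  have lborel_g: "lborel = distr lborel borel g"
    using lborel_complex_eq_distr_real2 by (simp add: g_def[abs_def])
  have m: "(*) w \<in> borel_measurable borel"
    by (intro borel_measurable_continuous_onI continuous_intros)
  have orth: "orthogonal_transformation f"
    unfolding orthogonal_transformation
  proof
    show "linear f"
      by (rule linearI) (auto simp: f_def g_def v_def vec_eq_iff forall_2 Complex_eq algebra_simps)
    have norm_v: "norm (v z) = cmod z" for z
      by (simp add: v_def norm_vec_def L2_set_def sum_2 cmod_def)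
    have "norm (f x) = norm (v (g x))" for x
      unfolding f_def norm_v by (simp add: norm_mult norm_inverse w)
    then show "\<forall>x. norm (f x) = norm x" by (simp only: vg simp_thms)
  qed
  fix l u :: complex
  assume le: "\<And>b. b \<in> Basis \<Longrightarrow> l \<bullet> b \<le> u \<bullet> b"
  let ?X = "g -` box l u"
  have Xb: "?X = box (v l) (v u)"
    by (auto simp: g_def v_def box_def Basis_complex_def Basis_vec_def inner_axis forall_2 axis_eq_axis)
  then have X: "?X \<in> lmeasurable" by simp
  have fX: "g -` ((*) w -` box l u) = f ` ?X"
  proof (intro equalityI subsetI)
    fix x assume "x \<in> g -` ((*) w -` box l u)"
    then have "x = f (v (w * g x))" "v (w * g x) \<in> ?X" using w0 by (simp_all add: f_def vg flip: mult.assoc)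
    then show "x \<in> f ` ?X" by blast
  qed (use w0 in \<open>auto simp: f_def simp flip: mult.assoc\<close>)
  have b: "(*) w -` box l u \<in> sets borel" using measurable_sets[OF m, of "box l u"] by simp
  have b2: "f ` ?X \<in> sets borel" using measurable_sets[OF g b] by (simp add: fX)
  have "emeasure (distr lborel borel ((*) w)) (box l u) = emeasure lborel ((*) w -` box l u)"
    using m by (subst emeasure_distr) auto
  also have "\<dots> = emeasure lborel (f ` ?X)"
    using g b by (subst lborel_g, subst emeasure_distr) (auto simp: fX)
  also have "\<dots> = emeasure lebesgue (f ` ?X)" using b2 by simp
  also have "\<dots> = measure lebesgue (f ` ?X)"
    using measurable_orthogonal_image[OF orth X] by (rule emeasure_eq_measure2)
  also have "\<dots> = measure lebesgue ?X" by (simp add: measure_orthogonal_image[OF orth X])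
  also have "\<dots> = emeasure lebesgue ?X" using emeasure_eq_measure2[OF X] by simp
  also have "\<dots> = emeasure lborel ?X" by (simp add: Xb)
  also have "\<dots> = emeasure (distr lborel borel g) (box l u)"
    using g by (simp add: emeasure_distr)
  also have "\<dots> = emeasure lborel (box l u)"
    by (simp only: lborel_g[symmetric])
  also have "\<dots> = ennreal (\<Prod>b\<in>Basis. (u - l) \<bullet> b)"
    using le by (simp add: emeasure_lborel_box)
  finally show "emeasure (distr lborel borel ((*) w)) (box l u) = ennreal (\<Prod>b\<in>Basis. (u - l) \<bullet> b)"
    by simp
qed simp

lemma integral_complex_rotate:
  fixes f :: "complex \<Rightarrow> complex"
  assumes w: "cmod w = 1" and f: "f \<in> borel_measurable borel"
  shows "(LINT z|lborel. f (w * z)) = (LINT z|lborel. f z)"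
proof -
  have "(*) w \<in> borel_measurable borel"
    by (intro borel_measurable_continuous_onI continuous_intros)
  then have "(LINT z|lborel. f (w * z)) = (LINT z|distr lborel borel ((*) w). f z)"
    using f by (subst integral_distr) auto
  then show ?thesis by (simp add: lborel_distr_rotation[OF w])
qed

lemma integral_complex_scale:
  fixes f :: "complex \<Rightarrow> real"
  assumes r: "r > 0" and f: "f \<in> borel_measurable borel"
  shows "(LINT z|lborel. f z) = r\<^sup>2 * (LINT z|lborel. f (r *\<^sub>R z))"
proof -
  have m: "(\<lambda>z::complex. r *\<^sub>R z) \<in> borel_measurable borel"
    by (intro borel_measurable_continuous_onI continuous_intros)
  have "lborel = density (distr lborel borel (\<lambda>z::complex. r *\<^sub>R z)) (\<lambda>_. ennreal (r\<^sup>2))"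
    using lborel_affine[of r "0::complex"] r by simp
  then have "(LINT z|lborel. f z) =
      (LINT z|density (distr lborel borel (\<lambda>z::complex. r *\<^sub>R z)) (\<lambda>_. ennreal (r\<^sup>2)). f z)"
    by simp
  also have "\<dots> = (LINT z|distr lborel borel (\<lambda>z::complex. r *\<^sub>R z). r\<^sup>2 * f z)"
    using f by (subst integral_density) auto
  also have "\<dots> = (LINT z|lborel. r\<^sup>2 * f (r *\<^sub>R z))"
    using f m by (subst integral_distr) auto
  finally show ?thesis by simp
qed

lemma measure_ball_complex: "r \<ge> 0 \<Longrightarrow> measure lborel (ball (0::complex) r) = pi * r\<^sup>2"
  using content_ball[of r "0::complex"] by (simp add: unit_ball_vol_2)

text \<open>
  Let \<open>J\<close> be the integral.  By scaling, the integral over the disk of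
  radius \<open>r < 1\<close> is \<open>r\<^bsup>2j+2\<^esup> J\<close>, so the annulus \<open>r \<le> |z| < 1\<close> contributes \<open>J (1 - r\<^bsup>2j+2\<^esup>)\<close>.
  There the integrand lies between \<open>r\<^bsup>2j\<^esup>\<close> and \<open>1\<close>, and the area is \<open>\<pi> (1 - r\<^sup>2)\<close>.  Dividing by \<open>1 - r\<^sup>2\<close>
  gives \<open>\<pi> r\<^bsup>2j\<^esup> \<le> J (1 + r\<^sup>2 + \<cdots> + r\<^bsup>2j\<^esup>) \<le> \<pi>\<close>, and \<open>r\<close> tends to \<open>1\<close>.
\<close>

lemma integral_norm_power_disk:
  "(LINT z|lborel. indicator (ball 0 1) z * cmod z ^ (2 * j)) = pi / real (j + 1)"
proof -
  define f where "f r z = indicator (ball 0 r) z * cmod z ^ (2 * j)" for r :: real and z :: complex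
  have [measurable]: "f r \<in> borel_measurable borel" for r
    unfolding f_def
    by (intro borel_measurable_times borel_measurable_indicator borel_measurable_continuous_onI
        continuous_intros) auto
  define J where "J = (LINT z|lborel. f 1 z)"
  have ib: "integrable lborel (\<lambda>z::complex. c * indicator (ball 0 r) z :: real)" for c r
    by (intro integrable_mult_right) (simp add: integrable_indicator_iff emeasure_bounded_finite[simplified])
  have pw: "cmod z ^ (2 * j) \<le> 1" if "cmod z < 1" for z
    using that by (intro power_le_one) auto
  have int: "integrable lborel (f r)" if "r \<le> 1" for r
  proof (rule Bochner_Integration.integrable_bound[OF ib[of 1 1]])
    show "AE z in lborel. norm (f r z) \<le> norm (1 * indicator (ball 0 1) z :: real)"
      using that pw by (intro AE_I2) (auto simp: f_def indicator_def)
  qed simp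
  have scale: "(LINT z|lborel. f r z) = r ^ (2 * j + 2) * J" if "0 < r" for r
  proof -
    have "f r (r *\<^sub>R z) = r ^ (2 * j) * f 1 z" for z
      using that by (auto simp: f_def indicator_def power_mult_distrib)
    then show ?thesis
      using integral_complex_scale[OF that, of "f r"] by (simp add: J_def power_add power2_eq_square mult_ac)
  qed
  have annulus: "(LINT z::complex|lborel. c * (indicator (ball 0 1) z - indicator (ball 0 r) z)) =
      c * (pi * (1 - r\<^sup>2))"
    and annulus_int: "integrable lborel
      (\<lambda>z::complex. c * (indicator (ball 0 1) z - indicator (ball 0 r) z) :: real)"
    if "0 < r" for c r :: real
  proof -
    have i: "integrable lborel (indicator (ball (0::complex) s) :: _ \<Rightarrow> real)" for s
      using ib[of 1] by simp
    have "(LINT z|lborel. indicator (ball 0 1) z - indicator (ball (0::complex) r) z) = pi * (1 - r\<^sup>2)"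
      using that measure_ball_complex[of r] measure_ball_complex[of 1]
      by (subst Bochner_Integration.integral_diff[OF i i]) (simp add: right_diff_distrib)
    then show "(LINT z::complex|lborel. c * (indicator (ball 0 1) z - indicator (ball (0::complex) r) z)) =
        c * (pi * (1 - r\<^sup>2))"
      by simp
    show "integrable lborel
        (\<lambda>z::complex. c * (indicator (ball 0 1) z - indicator (ball 0 r) z) :: real)"
      by (intro integrable_mult_right Bochner_Integration.integrable_diff i)
  qed
  have bounds: "pi * r ^ (2 * j) \<le> J * (\<Sum>k<j + 1. r\<^sup>2 ^ k)" "J * (\<Sum>k<j + 1. r\<^sup>2 ^ k) \<le> pi"
    if r: "0 < r" "r < 1" for r
  proof -
    have diff: "(LINT z|lborel. f 1 z - f r z) = J * (\<Sum>k<j + 1. r\<^sup>2 ^ k) * (1 - r\<^sup>2)"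
    proof -
      have "(LINT z|lborel. f 1 z - f r z) = J * (1 - r\<^sup>2 ^ (j + 1))"
        using r scale[of r]
        by (simp add: int J_def[symmetric] algebra_simps power2_eq_square[of r] power_mult_distrib
            mult_2_right power_add)
      also have "1 - r\<^sup>2 ^ (j + 1) = (1 - r\<^sup>2) * (\<Sum>k<j + 1. r\<^sup>2 ^ k)"
        by (rule one_diff_power_eq)
      finally show ?thesis by (simp only: mult_ac)
    qed
    have pos: "1 - r\<^sup>2 > 0" using r by (simp add: power_less_one_iff)
    have "(LINT z::complex|lborel. r ^ (2 * j) * (indicator (ball 0 1) z - indicator (ball 0 r) z))
        \<le> (LINT z|lborel. f 1 z - f r z)"
      using r by (intro integral_mono annulus_int Bochner_Integration.integrable_diff int)
        (auto simp: f_def indicator_def intro!: power_mono)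
    then have "(pi * r ^ (2 * j)) * (1 - r\<^sup>2) \<le> (J * (\<Sum>k<j + 1. r\<^sup>2 ^ k)) * (1 - r\<^sup>2)"
      using annulus[OF r(1), of "r ^ (2 * j)"] by (simp only: diff mult_ac)
    then show "pi * r ^ (2 * j) \<le> J * (\<Sum>k<j + 1. r\<^sup>2 ^ k)"
      using pos by (rule mult_right_le_imp_le)
    have "(LINT z|lborel. f 1 z - f r z)
        \<le> (LINT z::complex|lborel. 1 * (indicator (ball 0 1) z - indicator (ball 0 r) z))"
      using r pw by (intro integral_mono annulus_int Bochner_Integration.integrable_diff int)
        (auto simp: f_def indicator_def)
    then have "(J * (\<Sum>k<j + 1. r\<^sup>2 ^ k)) * (1 - r\<^sup>2) \<le> pi * (1 - r\<^sup>2)"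
      using annulus[OF r(1), of 1] by (simp only: diff mult_1_left)
    then show "J * (\<Sum>k<j + 1. r\<^sup>2 ^ k) \<le> pi"
      using pos by (rule mult_right_le_imp_le)
  qed
  have ev: "\<forall>\<^sub>F r in at_left (1::real). 0 < r \<and> r < 1"
    using eventually_at_left_real[of 0 "1::real"] by (auto elim: eventually_mono)
  have lim: "((\<lambda>r. J * (\<Sum>k<j + 1. r\<^sup>2 ^ k)) \<longlongrightarrow> J * (\<Sum>k<j + 1. 1\<^sup>2 ^ k)) (at_left (1::real))"
    by (intro tendsto_intros)
  have lim2: "((\<lambda>r. pi * r ^ (2 * j)) \<longlongrightarrow> pi * 1 ^ (2 * j)) (at_left (1::real))"
    by (intro tendsto_intros)
  have "pi * 1 ^ (2 * j) \<le> J * (\<Sum>k<j + 1. 1\<^sup>2 ^ k)"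
    by (rule tendsto_le[OF _ lim lim2]) (use ev bounds(1) in \<open>auto elim: eventually_mono\<close>)
  moreover have "J * (\<Sum>k<j + 1. 1\<^sup>2 ^ k) \<le> pi"
    by (rule tendsto_upperbound[OF lim]) (use ev bounds(2) in \<open>auto elim: eventually_mono\<close>)
  ultimately have "J * real (j + 1) = pi" by simp
  then show ?thesis by (simp add: J_def f_def field_simps)
qed

text \<open>
  For \<open>i \<noteq> j\<close> the rotation by the angle \<open>\<pi> / (j - i)\<close> changes the sign of \<open>cnj z ^ i * z ^ j\<close>, so its
  integral over the disk vanishes.
\<close>

lemma bergman_inner_h_fun:
  "bergman_inner (h_fun i) (h_fun j) = (if i = j then of_nat (i + 1) else 0)"
proof -
  define g where "g z = indicator (ball 0 1) z *\<^sub>R (cnj z ^ i * z ^ j)" for z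
  have g: "g \<in> borel_measurable borel"
    unfolding g_def by (intro borel_measurable_continuous_on_indicator continuous_intros) auto
  have "bergman_inner (h_fun i) (h_fun j) =
      (LINT z|lborel. (indicator (ball 0 1) z / pi) *\<^sub>R (of_nat (i + 1) * of_nat (j + 1) * g z))"
    unfolding bergman_inner.rep_eq disk_measure_def
  proof (subst integral_density)
    show "(\<lambda>z. cnj (Rep_bergman (h_fun i) z) * Rep_bergman (h_fun j) z) \<in> borel_measurable lborel"
      using borel_measurable_times[OF borel_measurable_continuous_on[OF continuous_on_cnj[OF
            continuous_on_id] bergman_measurable] bergman_measurable]
      by (simp add: disk_measure_def)
  qed (auto simp: h_fun.rep_eq g_def indicator_def intro!: Bochner_Integration.integral_cong)
  also have "\<dots> = of_nat (i + 1) * of_nat (j + 1) / of_real pi * (LINT z|lborel. g z)"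
  proof -
    have "(\<lambda>z. (indicator (ball 0 1) z / pi) *\<^sub>R (of_nat (i + 1) * of_nat (j + 1) * g z)) =
      (\<lambda>z. of_nat (i + 1) * of_nat (j + 1) / of_real pi * g z)"
      by (auto simp: g_def indicator_def fun_eq_iff scaleR_conv_of_real field_simps)
    then show ?thesis by simp
  qed
  finally have eq: "bergman_inner (h_fun i) (h_fun j) = \<dots>" .
  show ?thesis
  proof (cases "i = j")
    case True
    have "g z = of_real (indicator (ball 0 1) z * cmod z ^ (2 * j))" for z
    proof -
      have "cnj z ^ j * z ^ j = of_real (cmod z ^ (2 * j))"
        by (metis complex_norm_square mult.commute of_real_power power_mult power_mult_distrib)
      then show ?thesis using True by (simp add: g_def scaleR_conv_of_real)
    qed
    then have "(LINT z|lborel. g z) = of_real (pi / real (j + 1))"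
      by (simp only: integral_complex_of_real integral_norm_power_disk)
    then show ?thesis unfolding eq using True of_nat_neq_0[of j, where 'a = complex] by simp
  next
    case False
    define w where "w = cis (pi / (real j - real i))"
    have "cnj w ^ i * w ^ j = cis ((real j - real i) * (pi / (real j - real i)))"
      unfolding w_def cis_cnj Complex.DeMoivre cis_mult
      by (rule arg_cong[of _ _ cis]) (simp add: left_diff_distrib diff_divide_distrib)
    then have w: "cnj w ^ i * w ^ j = - 1" using False by simp
    have w1: "cmod w = 1" by (simp add: w_def)
    have "g (w * z) = - g z" for z
    proof -
      have "g (w * z) = (cnj w ^ i * w ^ j) * g z"
        using w1 by (simp add: g_def indicator_def norm_mult power_mult_distrib)
      then show ?thesis by (simp add: w)
    qed
    then have "(LINT z|lborel. g z) = 0"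
      using integral_complex_rotate[OF w1 g] by simp
    then show ?thesis using False by (simp add: eq)
  qed
qed


section \<open>Symmetric tensors\<close>

text \<open>
  The values of \<open>\<Psi>\<close> are algebraic tensors, so the completed tensor powers enter only through this dense
  subspace, on which \<open>tensor_inner\<close> is the computable form \<open>alg_inner\<close>.
\<close>

definition alg_functionals :: "nat \<Rightarrow> (bergman list \<Rightarrow> complex) set" where
  "alg_functionals p = tensor_sum ` alg_tensors p"

lemma alg_tensors_add: "u \<in> alg_tensors p \<Longrightarrow> v \<in> alg_tensors p \<Longrightarrow> u + v \<in> alg_tensors p"
  unfolding alg_tensors_def by (force simp: in_keys_iff lookup_add)

lemma add_eq_diff_scale: "u + v = u - free_scale (- 1) v"
  by (rule poly_mapping_eqI) (simp add: lookup_add lookup_minus)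

lemma tensor_sum_add: "tensor_sum (u + v) gs = tensor_sum u gs + tensor_sum v gs"
  unfolding add_eq_diff_scale tensor_sum_diff tensor_sum_scale by simp

lemma alg_inner_add_left: "alg_inner (u + v) w = alg_inner u w + alg_inner v w"
  unfolding add_eq_diff_scale alg_inner_diff_left alg_inner_scale_left by simp

lemma alg_inner_add_right: "alg_inner u (v + w) = alg_inner u v + alg_inner u w"
  unfolding add_eq_diff_scale alg_inner_diff_right alg_inner_scale_right by simp

lemma alg_functionals_zero: "0 \<in> alg_functionals p"
proof -
  have "tensor_sum 0 = 0" by (simp add: tensor_sum_def fun_eq_iff)
  moreover have "0 \<in> alg_tensors p" by (simp add: alg_tensors_def)
  ultimately show ?thesis unfolding alg_functionals_def by (metis imageI)
qed

lemma alg_functionals_add: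
  assumes "\<phi> \<in> alg_functionals p" "\<psi> \<in> alg_functionals p"
  shows "\<phi> + \<psi> \<in> alg_functionals p"
proof -
  obtain u v where "\<phi> = tensor_sum u" "u \<in> alg_tensors p" "\<psi> = tensor_sum v" "v \<in> alg_tensors p"
    using assms by (auto simp: alg_functionals_def)
  then show ?thesis
    unfolding alg_functionals_def
    by (intro image_eqI[of _ _ "u + v"]) (auto simp: fun_eq_iff tensor_sum_add alg_tensors_add)
qed

lemma alg_functionals_scale:
  assumes "\<phi> \<in> alg_functionals p"
  shows "(\<lambda>gs. c * \<phi> gs) \<in> alg_functionals p"
proof -
  obtain u where "\<phi> = tensor_sum u" "u \<in> alg_tensors p"
    using assms by (auto simp: alg_functionals_def)
  then show ?thesis
    unfolding alg_functionals_def
    by (intro image_eqI[of _ _ "free_scale c u"]) (auto simp: fun_eq_iff tensor_sum_scale alg_tensors_scale)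
qed

lemma alg_functionals_sum:
  "finite A \<Longrightarrow> (\<And>i. i \<in> A \<Longrightarrow> \<phi> i \<in> alg_functionals p) \<Longrightarrow> (\<lambda>gs. \<Sum>i\<in>A. \<phi> i gs) \<in> alg_functionals p"
proof (induction A rule: finite_induct)
  case empty
  show ?case using alg_functionals_zero by (simp add: zero_fun_def)
next
  case (insert i A)
  then show ?case
    using alg_functionals_add[of "\<phi> i" p "\<lambda>gs. \<Sum>i\<in>A. \<phi> i gs"] by (simp add: plus_fun_def)
qed

lemma tensor_in_alg_functionals: "length fs = p \<Longrightarrow> tensor fs \<in> alg_functionals p"
  unfolding alg_functionals_def
  by (intro image_eqI[OF _ single_alg_tensors[of fs p 1]]) (auto simp: fun_eq_iff)

lemma alg_functionals_tensor_power: "alg_functionals p \<subseteq> tensor_power p"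
  using represents_const by (auto simp: alg_functionals_def tensor_power_def)

lemma tensor_inner_add_left:
  assumes "\<phi> \<in> alg_functionals p" "\<phi>' \<in> alg_functionals p" "\<psi> \<in> alg_functionals p"
  shows "tensor_inner p (\<phi> + \<phi>') \<psi> = tensor_inner p \<phi> \<psi> + tensor_inner p \<phi>' \<psi>"
proof -
  obtain u u' v where *: "\<phi> = tensor_sum u" "\<phi>' = tensor_sum u'" "\<psi> = tensor_sum v"
    "u \<in> alg_tensors p" "u' \<in> alg_tensors p" "v \<in> alg_tensors p"
    using assms by (auto simp: alg_functionals_def)
  have "\<phi> + \<phi>' = tensor_sum (u + u')" by (simp add: * fun_eq_iff tensor_sum_add)
  then show ?thesis by (simp add: * tensor_inner_tensor_sum alg_tensors_add alg_inner_add_left)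
qed

lemma tensor_inner_add_right:
  assumes "\<phi> \<in> alg_functionals p" "\<psi> \<in> alg_functionals p" "\<psi>' \<in> alg_functionals p"
  shows "tensor_inner p \<phi> (\<psi> + \<psi>') = tensor_inner p \<phi> \<psi> + tensor_inner p \<phi> \<psi>'"
proof -
  obtain u v v' where *: "\<phi> = tensor_sum u" "\<psi> = tensor_sum v" "\<psi>' = tensor_sum v'"
    "u \<in> alg_tensors p" "v \<in> alg_tensors p" "v' \<in> alg_tensors p"
    using assms by (auto simp: alg_functionals_def)
  have "\<psi> + \<psi>' = tensor_sum (v + v')" by (simp add: * fun_eq_iff tensor_sum_add)
  then show ?thesis by (simp add: * tensor_inner_tensor_sum alg_tensors_add alg_inner_add_right)
qed

lemma tensor_inner_scale_left:
  assumes "\<phi> \<in> alg_functionals p" "\<psi> \<in> alg_functionals p"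
  shows "tensor_inner p (\<lambda>gs. c * \<phi> gs) \<psi> = cnj c * tensor_inner p \<phi> \<psi>"
proof -
  obtain u v where *: "\<phi> = tensor_sum u" "\<psi> = tensor_sum v" "u \<in> alg_tensors p" "v \<in> alg_tensors p"
    using assms by (auto simp: alg_functionals_def)
  have "(\<lambda>gs. c * \<phi> gs) = tensor_sum (free_scale c u)" by (simp add: * fun_eq_iff tensor_sum_scale)
  then show ?thesis by (simp add: * tensor_inner_tensor_sum alg_tensors_scale alg_inner_scale_left)
qed

lemma tensor_inner_scale_right:
  assumes "\<phi> \<in> alg_functionals p" "\<psi> \<in> alg_functionals p"
  shows "tensor_inner p \<phi> (\<lambda>gs. c * \<psi> gs) = c * tensor_inner p \<phi> \<psi>"
proof -
  obtain u v where *: "\<phi> = tensor_sum u" "\<psi> = tensor_sum v" "u \<in> alg_tensors p" "v \<in> alg_tensors p"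
    using assms by (auto simp: alg_functionals_def)
  have "(\<lambda>gs. c * \<psi> gs) = tensor_sum (free_scale c v)" by (simp add: * fun_eq_iff tensor_sum_scale)
  then show ?thesis by (simp add: * tensor_inner_tensor_sum alg_tensors_scale alg_inner_scale_right)
qed

lemma tensor_inner_zero_left: "\<psi> \<in> alg_functionals p \<Longrightarrow> tensor_inner p 0 \<psi> = 0"
  using tensor_inner_scale_left[OF alg_functionals_zero, of \<psi> p 0] by (simp add: zero_fun_def)

lemma tensor_inner_zero_right: "\<phi> \<in> alg_functionals p \<Longrightarrow> tensor_inner p \<phi> 0 = 0"
  using tensor_inner_scale_right[OF _ alg_functionals_zero, of \<phi> p 0] by (simp add: zero_fun_def)

lemma tensor_inner_sum_left:
  assumes "finite A" "\<And>i. i \<in> A \<Longrightarrow> \<phi> i \<in> alg_functionals p" "\<psi> \<in> alg_functionals p"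
  shows "tensor_inner p (\<lambda>gs. \<Sum>i\<in>A. \<phi> i gs) \<psi> = (\<Sum>i\<in>A. tensor_inner p (\<phi> i) \<psi>)"
  using assms(1,2)
proof (induction A rule: finite_induct)
  case empty
  show ?case using tensor_inner_zero_left[OF assms(3)] by (simp add: zero_fun_def)
next
  case (insert i A)
  then show ?case
    using tensor_inner_add_left[of "\<phi> i" p "\<lambda>gs. \<Sum>i\<in>A. \<phi> i gs"] alg_functionals_sum[of A \<phi> p] assms(3)
    by (simp add: plus_fun_def)
qed

text \<open>
  A functional \<open>\<psi>\<close> stands for the tensor whose inner product with each elementary tensor it records;
  hence pairing with an elementary tensor is evaluation.
\<close>

lemma tensor_inner_tensor_eval:
  assumes "length fs = p" "\<psi> \<in> alg_functionals p"
  shows "tensor_inner p (tensor fs) \<psi> = \<psi> fs"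
proof -
  obtain v where v: "\<psi> = tensor_sum v" "v \<in> alg_tensors p"
    using assms by (auto simp: alg_functionals_def)
  have "tensor fs = tensor_sum (Poly_Mapping.single fs 1)" by (simp add: fun_eq_iff)
  then show ?thesis
    using v assms(1)
    by (simp only: tensor_inner_tensor_sum single_alg_tensors) (simp add: alg_inner_def)
qed

lemma sym_op_tensor_expand:
  assumes "length fs = p"
  shows "sym_op p (tensor fs) =
    (\<lambda>gs. 1 / fact p * (\<Sum>\<sigma> | \<sigma> permutes {..<p}. tensor (map (\<lambda>i. fs ! \<sigma> i) [0..<p]) gs))"
  by (simp add: fun_eq_iff sym_op_tensor[OF assms])

lemma sym_op_tensor_in_alg_functionals:
  "length fs = p \<Longrightarrow> sym_op p (tensor fs) \<in> alg_functionals p"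
  by (simp only: sym_op_tensor_expand)
    (intro alg_functionals_scale alg_functionals_sum tensor_in_alg_functionals; simp add: finite_permutations)

text \<open>
  Averaging the previous lemma over all orderings of the factors: this expresses that symmetrisation
  is self-adjoint.
\<close>

lemma tensor_inner_sym_op_tensor:
  assumes fs: "length fs = p" and \<psi>: "\<psi> \<in> alg_functionals p"
  shows "tensor_inner p (sym_op p (tensor fs)) \<psi> = sym_op p \<psi> fs"
proof -
  have fin: "finite {\<sigma>. \<sigma> permutes {..<p}}" by (simp add: finite_permutations)
  have "tensor_inner p (sym_op p (tensor fs)) \<psi> =
      1 / fact p * (\<Sum>\<sigma> | \<sigma> permutes {..<p}. tensor_inner p (tensor (map (\<lambda>i. fs ! \<sigma> i) [0..<p])) \<psi>)"
    unfolding sym_op_tensor_expand[OF fs]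
    by (subst tensor_inner_scale_left)
      (auto intro!: alg_functionals_sum tensor_in_alg_functionals fin \<psi> tensor_inner_sum_left)
  then show ?thesis
    using fs \<psi> by (simp add: tensor_inner_tensor_eval sym_op_def)
qed

text \<open>
  An average over a group is unchanged when the argument is translated by a group element.
\<close>

lemma sym_op_idem: "sym_op p (sym_op p \<phi>) = sym_op p \<phi>"
proof
  fix gs :: "bergman list"
  show "sym_op p (sym_op p \<phi>) gs = sym_op p \<phi> gs"
  proof (cases "length gs = p")
    case True
    have "sym_op p \<phi> (map (\<lambda>i. gs ! \<sigma> i) [0..<p]) = sym_op p \<phi> gs" if \<sigma>: "\<sigma> permutes {..<p}" for \<sigma>
    proof -
      have "map (\<lambda>i. map (\<lambda>i. gs ! \<sigma> i) [0..<p] ! \<tau> i) [0..<p] = map (\<lambda>i. gs ! (\<sigma> \<circ> \<tau>) i) [0..<p]"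
        if "\<tau> permutes {..<p}" for \<tau>
        using permutes_in_image[OF that] by auto
      then have *: "(\<Sum>\<tau> | \<tau> permutes {..<p}. \<phi> (map (\<lambda>i. map (\<lambda>i. gs ! \<sigma> i) [0..<p] ! \<tau> i) [0..<p])) =
          (\<Sum>\<tau> | \<tau> permutes {..<p}. \<phi> (map (\<lambda>i. gs ! (\<sigma> \<circ> \<tau>) i) [0..<p]))"
        by (intro sum.cong refl arg_cong[of _ _ \<phi>]) blast
      then have "sym_op p \<phi> (map (\<lambda>i. gs ! \<sigma> i) [0..<p]) =
          (\<Sum>\<tau> | \<tau> permutes {..<p}. \<phi> (map (\<lambda>i. gs ! (\<sigma> \<circ> \<tau>) i) [0..<p])) / fact p"
        by (simp only: sym_op_def length_map length_upt diff_zero if_True refl)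
      also have "\<dots> = sym_op p \<phi> gs"
        using setum_permutations_compose_left[OF \<sigma>, of "\<lambda>\<tau>. \<phi> (map (\<lambda>i. gs ! \<tau> i) [0..<p])"] True
        by (simp add: sym_op_def)
      finally show ?thesis .
    qed
    then have "sym_op p (sym_op p \<phi>) gs = (\<Sum>\<sigma> | \<sigma> permutes {..<p}. sym_op p \<phi> gs) / fact p"
      using True by (simp add: sym_op_def[of p "sym_op p \<phi>"])
    then show ?thesis by (simp add: card_permutations)
  qed (simp add: sym_op_def)
qed

lemma tensor_inner_sym_op:
  assumes fs: "length fs = p" and gs: "length gs = p"
  shows "tensor_inner p (sym_op p (tensor fs)) (sym_op p (tensor gs)) =
    (\<Sum>\<sigma> | \<sigma> permutes {..<p}. \<Prod>i<p. bergman_inner (fs ! i) (gs ! \<sigma> i)) / fact p"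
proof -
  have "tensor_inner p (sym_op p (tensor fs)) (sym_op p (tensor gs)) = sym_op p (tensor gs) fs"
    by (simp add: assms tensor_inner_sym_op_tensor sym_op_tensor_in_alg_functionals sym_op_idem)
  then show ?thesis by (simp add: assms sym_op_tensor) (simp add: assms tensor_def)
qed

lemma sym_op_add: "sym_op p (\<phi> + \<psi>) = sym_op p \<phi> + sym_op p \<psi>"
  by (simp add: fun_eq_iff sym_op_def sum.distrib add_divide_distrib)

lemma sym_op_scale: "sym_op p (\<lambda>gs. c * \<phi> gs) = (\<lambda>gs. c * sym_op p \<phi> gs)"
  by (simp add: fun_eq_iff sym_op_def sum_distrib_left)

text \<open>
  The algebraic direct sum of the spaces \<open>V p\<close>.  It is used both for \<open>V p = alg_functionals p\<close>, where
  the inner product is sesquilinear, and for the symmetric functionals, which give membership in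
  \<open>sym_bergman\<close>.
\<close>

definition graded :: "(nat \<Rightarrow> (bergman list \<Rightarrow> complex) set) \<Rightarrow> (nat \<Rightarrow> bergman list \<Rightarrow> complex) set"
  where "graded V = {\<Phi>. (\<forall>p. \<Phi> p \<in> V p) \<and> finite {p. \<Phi> p \<noteq> 0}}"

lemma graded_add:
  assumes "\<And>p \<phi> \<psi>. \<phi> \<in> V p \<Longrightarrow> \<psi> \<in> V p \<Longrightarrow> \<phi> + \<psi> \<in> V p"
  shows "\<Phi> \<in> graded V \<Longrightarrow> \<Phi>' \<in> graded V \<Longrightarrow> \<Phi> + \<Phi>' \<in> graded V"
  unfolding graded_def
  by (auto intro: assms finite_subset[of _ "{p. \<Phi> p \<noteq> 0} \<union> {p. \<Phi>' p \<noteq> 0}"])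

lemma graded_scale:
  assumes "\<And>p \<phi> c. \<phi> \<in> V p \<Longrightarrow> (\<lambda>gs. c * \<phi> gs) \<in> V p"
  shows "\<Phi> \<in> graded V \<Longrightarrow> sym_scale c \<Phi> \<in> graded V"
  unfolding graded_def sym_scale_def
  by (auto intro: assms elim!: rev_finite_subset simp: fun_eq_iff)

lemma sym_embed_graded:
  assumes "\<And>p. 0 \<in> V p" "\<phi> \<in> V p"
  shows "sym_embed p \<phi> \<in> graded V"
  using assms by (auto simp: graded_def sym_embed_def intro: finite_subset[of _ "{p}"])

lemma sym_inner_superset:
  assumes "\<Psi> \<in> graded alg_functionals" "finite A" "\<And>p. p \<notin> A \<Longrightarrow> \<Phi> p = 0"
  shows "sym_inner \<Phi> \<Psi> = (\<Sum>p\<in>A. tensor_inner p (\<Phi> p) (\<Psi> p))"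
  unfolding sym_inner_def
  by (rule sum.mono_neutral_left) (use assms in \<open>auto simp: graded_def tensor_inner_zero_left\<close>)

lemma sym_inner_add_left:
  assumes "\<Phi> \<in> graded alg_functionals" "\<Phi>' \<in> graded alg_functionals" "\<Psi> \<in> graded alg_functionals"
  shows "sym_inner (\<Phi> + \<Phi>') \<Psi> = sym_inner \<Phi> \<Psi> + sym_inner \<Phi>' \<Psi>"
proof -
  define A where "A = {p. \<Phi> p \<noteq> 0} \<union> {p. \<Phi>' p \<noteq> 0}"
  have "finite A" using assms by (simp add: A_def graded_def)
  then have "sym_inner \<Theta> \<Psi> = (\<Sum>p\<in>A. tensor_inner p (\<Theta> p) (\<Psi> p))" if "\<Theta> \<in> {\<Phi>, \<Phi>', \<Phi> + \<Phi>'}" for \<Theta>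
    using assms that by (intro sym_inner_superset) (auto simp: A_def)
  then show ?thesis
    using assms by (simp add: graded_def tensor_inner_add_left sum.distrib)
qed

lemma sym_inner_scale_left:
  assumes "\<Phi> \<in> graded alg_functionals" "\<Psi> \<in> graded alg_functionals"
  shows "sym_inner (sym_scale c \<Phi>) \<Psi> = cnj c * sym_inner \<Phi> \<Psi>"
proof -
  define A where "A = {p. \<Phi> p \<noteq> 0}"
  have "finite A" using assms by (simp add: A_def graded_def)
  moreover have "sym_scale c \<Phi> p = 0" if "p \<notin> A" for p
    using that by (simp add: A_def sym_scale_def zero_fun_def)
  ultimately have "sym_inner (sym_scale c \<Phi>) \<Psi> = (\<Sum>p\<in>A. tensor_inner p (sym_scale c \<Phi> p) (\<Psi> p))"
    "sym_inner \<Phi> \<Psi> = (\<Sum>p\<in>A. tensor_inner p (\<Phi> p) (\<Psi> p))"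
    using assms by (auto intro!: sym_inner_superset simp: A_def)
  then show ?thesis
    using assms by (simp add: sym_scale_def graded_def tensor_inner_scale_left sum_distrib_left)
qed

lemma sym_inner_add_right:
  assumes "\<Phi> \<in> graded alg_functionals" "\<Psi> \<in> graded alg_functionals" "\<Psi>' \<in> graded alg_functionals"
  shows "sym_inner \<Phi> (\<Psi> + \<Psi>') = sym_inner \<Phi> \<Psi> + sym_inner \<Phi> \<Psi>'"
  using assms by (simp add: sym_inner_def graded_def tensor_inner_add_right sum.distrib)

lemma sym_inner_scale_right:
  assumes "\<Phi> \<in> graded alg_functionals" "\<Psi> \<in> graded alg_functionals"
  shows "sym_inner \<Phi> (sym_scale c \<Psi>) = c * sym_inner \<Phi> \<Psi>"
  using assms by (simp add: sym_inner_def sym_scale_def graded_def tensor_inner_scale_right sum_distrib_left)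

lemma sym_inner_embed:
  assumes "\<phi> \<in> alg_functionals p" "\<psi> \<in> alg_functionals q"
  shows "sym_inner (sym_embed p \<phi>) (sym_embed q \<psi>) = (if p = q then tensor_inner p \<phi> \<psi> else 0)"
proof -
  have "sym_inner (sym_embed p \<phi>) (sym_embed q \<psi>) =
      (\<Sum>p\<in>{p}. tensor_inner p (sym_embed p \<phi> p) (sym_embed q \<psi> p))"
    by (subst sym_inner_superset[of _ "{p}"])
      (use assms in \<open>auto intro!: sym_embed_graded alg_functionals_zero\<close>, simp add: sym_embed_def)
  then show ?thesis
    using assms by (auto simp: sym_embed_def tensor_inner_zero_right)
qed

lemma graded_sym_op_subset: "graded (\<lambda>p. sym_op p ` alg_functionals p) \<subseteq> sym_bergman"
  using alg_functionals_tensor_power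
  by (fastforce simp: graded_def sym_bergman_def sym_power_def)


section \<open>The Heisenberg module\<close>

lemma abs_fock_eq_iff: "abs_fock a = abs_fock b \<longleftrightarrow> a - b \<in> heis_null"
  by (rule fock.abs_eq_iff)

lemma heis_act_add: "heis_act x (a + b) = heis_act x a + heis_act x b"
  by transfer (simp add: prepend_add heis_null_intros)

lemma heis_act_diff: "heis_act x (a - b) = heis_act x a - heis_act x b"
  by transfer (simp add: prepend_diff heis_null_intros)

lemma heis_act_scale: "heis_act x (fock_scale c a) = fock_scale c (heis_act x a)"
  by transfer (simp add: prepend_scale heis_null_intros)

lemma heis_act_zero [simp]: "heis_act x 0 = 0"
  by (metis heis_act_diff diff_self)

lemma abs_fock_word: "abs_fock (word w) = foldr heis_act w vac"
proof (induction w)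
  case Nil
  show ?case by (simp add: vac_def)
next
  case (Cons x w)
  have "abs_fock (word (x # w)) = heis_act x (abs_fock (word w))"
    by (simp add: heis_act.abs_eq prepend_single)
  then show ?case using Cons by simp
qed

lemma single_eq_scale_word: "Poly_Mapping.single w c = free_scale c (word w)"
  by (rule poly_mapping_eqI) (simp add: lookup_single when_def)

text \<open>
  Words span the tensor algebra, hence their classes span its quotient.
\<close>

lemma fock_word_induct [case_names zero add scale word]:
  assumes zero: "P 0" and add: "\<And>a b. P a \<Longrightarrow> P b \<Longrightarrow> P (a + b)"
    and scale: "\<And>c a. P a \<Longrightarrow> P (fock_scale c a)"
    and word: "\<And>w. P (foldr heis_act w vac)"
  shows "P a"
proof -
  have "P (abs_fock u)" for u
  proof (induction u rule: Poly_Mapping.update_induct)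
    case const
    show ?case using zero by (simp add: zero_fock_def)
  next
    case (update u w c)
    then have "Poly_Mapping.update w c u = u + free_scale c (word w)"
      by (intro poly_mapping_eqI)
        (auto simp: lookup_update lookup_add lookup_single when_def in_keys_iff)
    then have "abs_fock (Poly_Mapping.update w c u) =
        abs_fock u + fock_scale c (foldr heis_act w vac)"
      by (simp add: plus_fock.abs_eq fock_scale.abs_eq abs_fock_word[symmetric])
    then show ?case using update add scale word by simp
  qed
  then show ?thesis by (metis Quotient_fock Quotient_abs_rep)
qed

lemma abs_fock_relation: "a \<in> heis_relations \<Longrightarrow> abs_fock a = 0"
  by (simp add: zero_fock_def abs_fock_eq_iff heis_null_intros)

lemma heis_act_HCen: "heis_act HCen a = a"
proof (induction a rule: fock_word_induct)
  case (word w)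
  show ?case
  proof (induction w)
    case Nil
    show ?case
      using abs_fock_relation[OF vac_HCen[of "[]"]]
      by (simp add: minus_fock.abs_eq[symmetric] abs_fock_word)
  next
    case (Cons x w)
    then show ?case
      using abs_fock_relation[OF comm_HCen[of "[]" x w]]
      by (simp add: minus_fock.abs_eq[symmetric] abs_fock_word)
  qed
qed (simp_all add: heis_act_add heis_act_scale)

lemma h_commute:
  "h m (h n a) = h n (h m a) + (if m + n = 0 then fock_scale (of_int m) a else 0)"
proof (induction a rule: fock_word_induct)
  case (word w)
  show ?case
    using abs_fock_relation[OF comm_HGen[of "[]" m n w]]
    by (auto simp: minus_fock.abs_eq[symmetric] abs_fock_word single_eq_scale_word[of _ "of_int m"]
        fock_scale.abs_eq[symmetric] zero_fock_def[symmetric] heis_act_HCen diff_eq_eq add.commute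
        split: if_splits)
qed (auto simp: heis_act_add heis_act_scale fock.scale_right_distrib)

lemma h_vac: "n \<ge> 0 \<Longrightarrow> h n vac = 0"
  using abs_fock_relation[OF vac_HGen[of n "[]"]] by (simp add: abs_fock_word)

text \<open>
  Creation operators commute, so their products are indexed by multisets; this makes the choice of an
  ordering irrelevant until tensors are written down.
\<close>

definition creation_product :: "nat multiset \<Rightarrow> fock" where
  "creation_product M = fold_mset (\<lambda>i. h (- int i - 1)) vac M"

interpretation creation: comp_fun_commute "\<lambda>i. h (- int i - 1)"
proof
  show "(\<lambda>a. h (- int j - 1) a) \<circ> (\<lambda>a. h (- int i - 1) a) =
      (\<lambda>a. h (- int i - 1) a) \<circ> (\<lambda>a. h (- int j - 1) a)" for i j
    using h_commute[of "- int j - 1" "- int i - 1"] by (simp add: fun_eq_iff)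
qed

lemma creation_product_empty [simp]: "creation_product {#} = vac"
  by (simp add: creation_product_def)

lemma creation_product_add_mset [simp]:
  "creation_product (add_mset i M) = h (- int i - 1) (creation_product M)"
  by (simp add: creation_product_def)

text \<open>
  Up to the factor \<open>i + 1\<close>, the annihilation operator \<open>h(i+1)\<close> acts as the derivation that removes
  one factor \<open>h(-i-1)\<close>.
\<close>

lemma h_Suc_creation_product:
  "h (int i + 1) (creation_product M) =
   fock_scale (of_nat ((i + 1) * count M i)) (creation_product (M - {#i#}))"
proof (induction M)
  case empty
  show ?case by (simp add: h_vac)
next
  case (add j M)
  show ?case
  proof (cases "i = j")
    case True
    let ?n = "of_nat ((j + 1) * count M j) :: complex"
    have "fock_scale ?n (h (- int j - 1) (creation_product (M - {#j#}))) =
        fock_scale ?n (creation_product M)"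
    proof (cases "j \<in># M")
      case True
      then show ?thesis using creation_product_add_mset[of j "M - {#j#}"] by simp
    next
      case False
      then show ?thesis by (simp add: not_in_iff)
    qed
    then have "h (int j + 1) (creation_product (add_mset j M)) =
        fock_scale ?n (creation_product M) + fock_scale (of_int (int j + 1)) (creation_product M)"
      using add[unfolded True] h_commute[of "int j + 1" "- int j - 1" "creation_product M"]
      by (simp add: heis_act_scale)
    then show ?thesis
      unfolding True by (simp add: algebra_simps flip: fock.scale_left_distrib)
  next
    case False
    then have "add_mset j M - {#i#} = add_mset j (M - {#i#})" by simp
    with False add show ?thesis
      by (simp add: h_commute[of "int i + 1" "- int j - 1"] heis_act_scale)
  qed
qed

lemma h_zero_creation_product: "h 0 (creation_product M) = 0"
proof (induction M)
  case (add i M)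
  then show ?case using h_commute[of 0 "- int i - 1" "creation_product M"] by simp
qed (simp add: h_vac)

text \<open>
  The span of the products of creation operators contains the vacuum and is stable under the
  Heisenberg algebra, so it is the whole module.
\<close>

lemma fock_induct [case_names zero add scale product]:
  assumes zero: "P 0" and add: "\<And>a b. P a \<Longrightarrow> P b \<Longrightarrow> P (a + b)"
    and scale: "\<And>c a. P a \<Longrightarrow> P (fock_scale c a)"
    and product: "\<And>M. P (creation_product M)"
  shows "P a"
proof -
  define S where "S = fock.span (range creation_product)"
  have act: "heis_act x a \<in> S" if "a \<in> S" for x a
    using that unfolding S_def
  proof (induction rule: fock.span_induct_alt)
    case base
    show ?case by (simp add: fock.span_zero)
  next
    case (step c a b)
    then obtain M where M: "a = creation_product M" by auto
    have "heis_act x a \<in> fock.span (range creation_product)"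
    proof (cases x)
      case (HGen n)
      consider "n = 0" | i where "n = int i + 1" | i where "n = - int i - 1"
      proof -
        have "n = 0 \<or> n = int (nat (n - 1)) + 1 \<or> n = - int (nat (- n - 1)) - 1" by linarith
        then show ?thesis using that by blast
      qed
      then show ?thesis
      proof cases
        case 1
        then show ?thesis by (simp add: HGen M h_zero_creation_product fock.span_zero)
      next
        case 2
        then show ?thesis
          by (simp add: HGen M h_Suc_creation_product fock.span_scale fock.span_base del: of_nat_mult)
      next
        case (3 i)
        then have "heis_act x a = creation_product (add_mset i M)" by (simp add: HGen M)
        then show ?thesis by (simp only: fock.span_base rangeI)
      qed
    next
      case HCen
      then show ?thesis by (simp add: heis_act_HCen M fock.span_base)
    qed
    then show ?case
      using step by (simp add: heis_act_add heis_act_scale fock.span_add fock.span_scale)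
  qed
  have "foldr heis_act w vac \<in> S" for w
  proof (induction w)
    case Nil
    have "creation_product {#} \<in> S" unfolding S_def by (intro fock.span_base rangeI)
    then show ?case by simp
  qed (simp add: act)
  then have "a \<in> S"
    by (induction a rule: fock_word_induct)
      (auto simp: S_def fock.span_zero fock.span_add fock.span_scale)
  then show "P a"
    unfolding S_def
    by (induction rule: fock.span_induct_alt) (auto intro: assms)
qed

lemma foldr_h_eq_creation_product:
  "foldr (\<lambda>k. h (- int k)) (map Suc xs) vac = creation_product (mset xs)"
proof (induction xs)
  case (Cons i xs)
  have "- int (Suc i) = - int i - 1" by simp
  then show ?case using Cons by (simp only: list.map foldr.simps o_apply mset.simps creation_product_add_mset)
qed simp

lemma creation_product_funpow:
  "(h (- int i - 1) ^^ k) (creation_product M) = creation_product (replicate_mset k i + M)"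
  by (induction k) simp_all

lemma fock_monomial_eq_creation_product:
  "fock_monomial iks = creation_product (mset (concat (map (\<lambda>(i, k). replicate k i) iks)))"
proof (induction iks)
  case (Cons ik iks)
  then show ?case
    by (cases ik) (simp add: fock_monomial_def creation_product_funpow)
qed (simp add: fock_monomial_def)

lemma heisenberg_mode_h:
  assumes "heisenberg_vertex_algebra Y"
  shows "Y (h (- 1) vac) n = h n"
  using assms by (simp add: heisenberg_vertex_algebra_def)

text \<open>
  The Borcherds identity with \<open>p = 0\<close>, \<open>r = -1\<close> expresses the modes of \<open>a(-1)b\<close> as the normally
  ordered product of those of \<open>a\<close> and \<open>b\<close>.  Both are taken to be \<open>h(-1)\<one>\<close>.
\<close>

lemma vir_eq_normal_ordered:
  assumes "heisenberg_vertex_algebra Y"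
  shows "vir Y n c = fock_scale (1 / 2)
    (Sum_any (\<lambda>i. h (- 1 - int i) (h (n + 1 + int i) c) + h (n - int i) (h (int i) c)))"
proof -
  interpret vertex_algebra fock_scale Y vac
    using assms by (simp add: heisenberg_vertex_algebra_def)
  let ?a = "h (- 1) vac"
  have Yh: "Y ?a m = h m" for m by (rule heisenberg_mode_h[OF assms])
  have lin: "Y (fock_scale c a) m b = fock_scale c (Y a m b)" for c a m b
    by (rule module_hom.scale[OF module_hom_linearI[OF mode_linear_left]])
  have "Sum_any (\<lambda>i::nat. fock_scale (of_int 0 gchoose i) (Y (Y ?a (- 1 + int i) ?a) (0 + (n + 1) - int i) c))
     = Sum_any (\<lambda>i::nat. if i = 0 then Y (h (- 1) ?a) (n + 1) c else 0)"
  proof (intro arg_cong[of _ _ Sum_any] ext)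
    show "fock_scale (of_int 0 gchoose i) (Y (Y ?a (- 1 + int i) ?a) (0 + (n + 1) - int i) c) =
        (if i = 0 then Y (h (- 1) ?a) (n + 1) c else 0)" for i
      by (cases i) (simp_all add: Yh)
  qed
  also have "\<dots> = Y (h (- 1) ?a) (n + 1) c"
    by (subst Sum_any.expand_superset[of "{0}"]) auto
  finally have "Y (h (- 1) ?a) (n + 1) c =
    Sum_any (\<lambda>i::nat. fock_scale ((- 1) ^ i * (of_int (- 1) gchoose i))
         (Y ?a (0 + - 1 - int i) (Y ?a (n + 1 + int i) c)
          - fock_scale ((- 1) powi (- 1)) (Y ?a (n + 1 + - 1 - int i) (Y ?a (0 + int i) c))))"
    using borcherds[of 0 ?a "- 1" ?a "n + 1" c] by simp
  also have "\<dots> = Sum_any (\<lambda>i. h (- 1 - int i) (h (n + 1 + int i) c) + h (n - int i) (h (int i) c))"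
  proof (intro arg_cong[of _ _ Sum_any] ext)
    fix i
    \<comment> \<open>upper negation: \<open>(-1 choose i) = (-1)^i (i choose i)\<close>\<close>
    have "(- 1) ^ i * ((- 1 :: complex) gchoose i) = 1"
      using gbinomial_negated_upper[of "- 1::complex" i] by (simp flip: binomial_gbinomial power_mult_distrib)
    then show "fock_scale ((- 1) ^ i * (of_int (- 1) gchoose i))
         (Y ?a (0 + - 1 - int i) (Y ?a (n + 1 + int i) c)
          - fock_scale ((- 1) powi (- 1)) (Y ?a (n + 1 + - 1 - int i) (Y ?a (0 + int i) c))) =
       h (- 1 - int i) (h (n + 1 + int i) c) + h (n - int i) (h (int i) c)"
      by (simp add: Yh)
  qed
  finally show ?thesis by (simp add: vir_def lin)
qed

lemma h_on_generator: "n \<ge> 0 \<Longrightarrow> h n (h (- 1) vac) = (if n = 1 then vac else 0)"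
  by (simp add: h_commute[of n "- 1"] h_vac)

lemma vir_0_generator:
  assumes "heisenberg_vertex_algebra Y"
  shows "vir Y 0 (h (- 1) vac) = h (- 1) vac"
proof -
  have "Sum_any (\<lambda>i. h (- 1 - int i) (h (0 + 1 + int i) (h (- 1) vac))
        + h (0 - int i) (h (int i) (h (- 1) vac)))
     = (\<Sum>i\<in>{0,1}. h (- 1 - int i) (h (0 + 1 + int i) (h (- 1) vac))
        + h (0 - int i) (h (int i) (h (- 1) vac)))"
    by (rule Sum_any.expand_superset) (auto simp: h_on_generator)
  also have "\<dots> = fock_scale 2 (h (- 1) vac)"
    using fock.scale_left_distrib[of 1 1 "h (- 1) vac"] by (simp add: h_on_generator)
  finally show ?thesis
    by (simp add: vir_eq_normal_ordered[OF assms])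
qed

lemma vir_1_generator:
  assumes "heisenberg_vertex_algebra Y"
  shows "vir Y 1 (h (- 1) vac) = 0"
proof -
  have "h (- 1 - int i) (h (1 + 1 + int i) (h (- 1) vac)) + h (1 - int i) (h (int i) (h (- 1) vac)) = 0" for i
    by (cases "i = 1") (auto simp: h_on_generator h_vac)
  then show ?thesis
    by (simp add: vir_eq_normal_ordered[OF assms])
qed

text \<open>
  The generator \<open>a = h(-1)\<one>\<close> is primary of weight one: \<open>L(0)a = a\<close> and \<open>L(1)a = 0\<close>.  Only the term
  \<open>k = 0\<close> of its opposite mode survives, and the sign is \<open>(-1)\<^bsup>1\<^esup>\<close>.
\<close>

lemma invariant_form_h_adjoint:
  assumes Y: "heisenberg_vertex_algebra Y" and B: "normalized_invariant_form Y B"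
  shows "B (h j b) c = - B b (h (- j) c)"
proof -
  interpret vertex_algebra fock_scale Y vac
    using Y by (simp add: heisenberg_vertex_algebra_def)
  let ?a = "h (- 1) vac"
  have lin: "Vector_Spaces.linear fock_scale (*) (\<lambda>a. B a b)" and sym: "B a b = B b a" for a b
    using B by (auto simp: normalized_invariant_form_def)
  have "vir Y 1 0 = 0" unfolding vir_def by (rule module_hom.zero[OF module_hom_linearI[OF mode_linear_right]])
  then have "(vir Y 1 ^^ k) 0 = 0" for k
    by (induction k) simp_all
  then have L: "(vir Y 1 ^^ k) ?a = 0" if "k \<noteq> 0" for k
    using that by (cases k) (simp_all add: funpow_Suc_right vir_1_generator[OF Y] del: funpow.simps)
  have Y0: "Y 0 m b = 0" for m b
    by (rule module_hom.zero[OF module_hom_linearI[OF mode_linear_left]])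
  have "opposite_mode Y 1 ?a j c = (\<Sum>k\<in>{0}. fock_scale ((- 1) ^ 1 / fact k)
       (Y ((vir Y 1 ^^ k) ?a) (2 * int 1 - int k - j - 2) c))"
    unfolding opposite_mode_def
  proof (rule Sum_any.expand_superset)
    show "{k. fock_scale ((- 1) ^ 1 / fact k)
        (Y ((vir Y 1 ^^ k) ?a) (2 * int 1 - int k - j - 2) c) \<noteq> 0} \<subseteq> {0}"
      using L Y0 by force
  qed simp
  then have opp: "opposite_mode Y 1 ?a j c = - h (- j) c"
    by (simp add: heisenberg_mode_h[OF Y])
  have "vir Y 0 ?a = fock_scale (of_nat 1) ?a" by (simp add: vir_0_generator[OF Y])
  then have "B (Y ?a j b) c = B b (opposite_mode Y 1 ?a j c)"
    using B unfolding normalized_invariant_form_def by blast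
  also have "\<dots> = B (- h (- j) c) b" by (simp only: opp sym[of b])
  also have "\<dots> = - B (h (- j) c) b" by (rule module_hom.neg[OF module_hom_linearI[OF lin]])
  finally show ?thesis by (simp add: heisenberg_mode_h[OF Y] sym)
qed


section \<open>The invariant form as a permanent\<close>

text \<open>
  The Laplace expansion of a permanent along its last row.
\<close>

lemma sum_prod_permutations_expand:
  fixes A :: "nat \<Rightarrow> nat \<Rightarrow> 'a :: comm_ring_1"
  shows "(\<Sum>\<sigma> | \<sigma> permutes {..<Suc n}. \<Prod>i<Suc n. A i (\<sigma> i)) =
    (\<Sum>b<Suc n. A n b * (\<Sum>\<sigma> | \<sigma> permutes {..<n}. \<Prod>i<n. A i (Transposition.transpose n b (\<sigma> i))))"
proof -
  let ?t = "Transposition.transpose n"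
  have "(\<Sum>\<sigma> | \<sigma> permutes {..<Suc n}. \<Prod>i<Suc n. A i (\<sigma> i)) =
      (\<Sum>b<Suc n. \<Sum>\<sigma> | \<sigma> permutes {..<n}. \<Prod>i<Suc n. A i ((?t b \<circ> \<sigma>) i))"
    unfolding lessThan_Suc by (rule sum_over_permutations_insert) auto
  also have "\<dots> = (\<Sum>b<Suc n. \<Sum>\<sigma> | \<sigma> permutes {..<n}. A n b * (\<Prod>i<n. A i (?t b (\<sigma> i))))"
  proof (intro sum.cong refl)
    fix b \<sigma> assume "\<sigma> \<in> {\<sigma>. \<sigma> permutes {..<n}}"
    then have "\<sigma> n = n" using permutes_not_in[of \<sigma> "{..<n}" n] by simp
    then show "(\<Prod>i<Suc n. A i ((?t b \<circ> \<sigma>) i)) = A n b * (\<Prod>i<n. A i (?t b (\<sigma> i)))"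
      by (simp add: mult.commute)
  qed
  finally show ?thesis by (simp only: sum_distrib_left)
qed

text \<open>
  The permutation sum expands by swapping column \<open>b\<close> with the last one; dropping the last entry afterwards
  amounts to deleting \<open>ys ! b\<close>.
\<close>

lemma mset_remove_by_transpose:
  assumes "length ys = Suc n" "b < Suc n"
  shows "mset (map (\<lambda>i. ys ! Transposition.transpose n b i) [0..<n]) = mset ys - {#ys ! b#}"
proof -
  have p: "Transposition.transpose n b permutes {..<Suc n}"
    using assms(2) by (intro permutes_swap_id) auto
  have "mset (map (\<lambda>i. ys ! Transposition.transpose n b i) [0..<Suc n]) = mset ys"
    using mset_permute_list[of "Transposition.transpose n b" ys] p assms(1) by (simp add: permute_list_def)
  then have "add_mset (ys ! b) (mset (map (\<lambda>i. ys ! Transposition.transpose n b i) [0..<n])) = mset ys"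
    by (simp add: assms)
  then show ?thesis by (metis add_mset_remove_trivial)
qed

text \<open>
  The derivation rule for annihilation operators is the Laplace expansion of the permanent of the
  Gram matrix: the \<open>count N i\<close> columns \<open>b\<close> with \<open>ys ! b = i\<close> contribute equally, the others vanish.
  Lists are extended at the end because the expansion removes the last row.
\<close>

lemma pairing_eq_sum_permutations:
  fixes P :: "nat multiset \<Rightarrow> nat multiset \<Rightarrow> complex"
  assumes empty: "P {#} {#} = 1"
    and step: "\<And>i M N. P (add_mset i M) N = of_nat ((i + 1) * count N i) * P M (N - {#i#})"
    and len: "length xs = n" "length ys = n"
  shows "P (mset xs) (mset ys) =
    (\<Sum>\<sigma> | \<sigma> permutes {..<n}. \<Prod>k<n. if xs ! k = ys ! \<sigma> k then of_nat (xs ! k + 1) else 0)"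
  using len
proof (induction xs arbitrary: ys n rule: rev_induct)
  case Nil
  then show ?case by (simp add: empty)
next
  case (snoc x xs)
  then obtain m where n: "n = Suc m" and m: "length xs = m" by simp
  define D where "D k l = (if k = l then of_nat (k + 1) else 0 :: complex)" for k l :: nat
  define zs where "zs b = map (\<lambda>i. ys ! Transposition.transpose m b i) [0..<m]" for b
  have "(\<Sum>\<sigma> | \<sigma> permutes {..<n}. \<Prod>k<n. D ((xs @ [x]) ! k) (ys ! \<sigma> k)) =
      (\<Sum>b<n. D x (ys ! b) * (\<Sum>\<sigma> | \<sigma> permutes {..<m}. \<Prod>k<m. D (xs ! k) (ys ! Transposition.transpose m b (\<sigma> k))))"
    unfolding n using sum_prod_permutations_expand[where n = m and A = "\<lambda>k l. D ((xs @ [x]) ! k) (ys ! l)"]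
    by (simp add: nth_append m del: sum.lessThan_Suc prod.lessThan_Suc cong: prod.cong_simp)
  also have "\<dots> = (\<Sum>b<n. D x (ys ! b) * (\<Sum>\<sigma> | \<sigma> permutes {..<m}. \<Prod>k<m. D (xs ! k) (zs b ! \<sigma> k)))"
  proof (intro sum.cong refl arg_cong2[of _ _ _ _ "(*)"] prod.cong)
    fix \<sigma> b k assume "\<sigma> \<in> {\<sigma>. \<sigma> permutes {..<m}}" "k \<in> {..<m}"
    then have "\<sigma> k < m" using permutes_in_image[of \<sigma> "{..<m}" k] by simp
    then show "D (xs ! k) (ys ! Transposition.transpose m b (\<sigma> k)) = D (xs ! k) (zs b ! \<sigma> k)"
      by (simp add: zs_def)
  qed
  also have "\<dots> = (\<Sum>b<n. D x (ys ! b) * P (mset xs) (mset (zs b)))"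
  proof -
    have "P (mset xs) (mset (zs b)) = (\<Sum>\<sigma> | \<sigma> permutes {..<m}. \<Prod>k<m. D (xs ! k) (zs b ! \<sigma> k))" for b
      unfolding D_def by (rule snoc.IH[OF m]) (simp add: zs_def)
    then show ?thesis by simp
  qed
  also have "\<dots> = (\<Sum>b<n. if ys ! b = x then of_nat (x + 1) * P (mset xs) (mset ys - {#x#}) else 0)"
  proof (intro sum.cong refl)
    fix b assume "b \<in> {..<n}"
    then have "mset (zs b) = mset ys - {#ys ! b#}"
      using snoc.prems(2) n unfolding zs_def by (intro mset_remove_by_transpose) auto
    then show "D x (ys ! b) * P (mset xs) (mset (zs b)) =
        (if ys ! b = x then of_nat (x + 1) * P (mset xs) (mset ys - {#x#}) else 0)"
      by (auto simp: D_def)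
  qed
  also have "\<dots> = (\<Sum>b | b < n \<and> ys ! b = x. of_nat (x + 1) * P (mset xs) (mset ys - {#x#}))"
    by (intro sum.mono_neutral_cong_right) auto
  also have "\<dots> = of_nat (count (mset ys) x) * (of_nat (x + 1) * P (mset xs) (mset ys - {#x#}))"
  proof -
    have "count (mset ys) x = card {b. b < n \<and> ys ! b = x}"
      unfolding count_mset count_list_eq_length_filter length_filter_conv_card snoc.prems(2)
      by (simp only: eq_commute[of x])
    then show ?thesis by simp
  qed
  also have "\<dots> = P (mset (xs @ [x])) (mset ys)"
    by (simp add: step algebra_simps)
  finally show ?case by (simp only: D_def)
qed

context
  fixes Y :: "fock \<Rightarrow> int \<Rightarrow> fock \<Rightarrow> fock" and B :: "fock \<Rightarrow> fock \<Rightarrow> complex" and \<theta> :: "fock \<Rightarrow> fock"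
  assumes Y: "heisenberg_vertex_algebra Y" and B: "normalized_invariant_form Y B" and \<theta>: "theta_map \<theta>"
begin

lemma form_sym: "B a b = B b a"
  using B by (simp add: normalized_invariant_form_def)

lemma form_add_left: "B (a + b) c = B a c + B b c"
  and form_scale_left: "B (fock_scale z a) c = z * B a c"
  using B by (auto simp: normalized_invariant_form_def Vector_Spaces.linear_iff)

lemma form_scale_right: "B c (fock_scale z a) = z * B c a"
  by (metis form_sym form_scale_left)

lemma form_add_right: "B c (a + b) = B c a + B c b"
  by (metis form_sym form_add_left)

lemma form_zero_left: "B 0 c = 0"
  using form_scale_left[of 0] by simp

text \<open>
  The antilinear map \<open>\<theta>\<close> supplies the sign that cancels the one of \<open>invariant_form_h_adjoint\<close>: with
  respect to \<open>(\<theta>(a), b)\<close> the operators \<open>h(-k)\<close> and \<open>h(k)\<close> are adjoint, without a sign.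
\<close>

lemma theta_creation_product:
  "\<theta> (creation_product M) = fock_scale ((- 1) ^ size M) (creation_product M)"
proof -
  obtain xs where xs: "M = mset xs" by (metis ex_mset)
  have "\<forall>k\<in>set (map Suc xs). k \<ge> 1" by auto
  then have "\<theta> (foldr (\<lambda>k. h (- int k)) (map Suc xs) vac) =
      fock_scale ((- 1) ^ length (map Suc xs)) (foldr (\<lambda>k. h (- int k)) (map Suc xs) vac)"
    using \<theta> unfolding theta_map_def by blast
  then show ?thesis
    by (simp only: foldr_h_eq_creation_product xs length_map size_mset)
qed

lemma form_creation_product_add_mset:
  "B (\<theta> (creation_product (add_mset i M))) (creation_product N) =
   of_nat ((i + 1) * count N i) * B (\<theta> (creation_product M)) (creation_product (N - {#i#}))"
proof -
  have "B (\<theta> (creation_product (add_mset i M))) (creation_product N) =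
      (- 1) ^ Suc (size M) * B (h (- int i - 1) (creation_product M)) (creation_product N)"
    unfolding theta_creation_product form_scale_left by simp
  also have "\<dots> = (- 1) ^ size M * B (creation_product M) (h (int i + 1) (creation_product N))"
    by (simp add: invariant_form_h_adjoint[OF Y B] add.commute)
  also have "\<dots> = of_nat ((i + 1) * count N i) *
      ((- 1) ^ size M * B (creation_product M) (creation_product (N - {#i#})))"
    by (simp add: h_Suc_creation_product form_scale_right)
  finally show ?thesis
    by (simp only: theta_creation_product form_scale_left)
qed

lemma form_vac_left: "B (\<theta> vac) (creation_product N) = (if N = {#} then 1 else 0)"
proof -
  have "\<theta> vac = vac" using theta_creation_product[of "{#}"] by simp
  moreover have "B vac (creation_product N) = (if N = {#} then 1 else 0)"
  proof (cases N)
    case empty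
    then show ?thesis using B by (simp add: normalized_invariant_form_def)
  next
    case (add i N')
    have "B vac (h (- int i - 1) (creation_product N')) = - B (h (int i + 1) vac) (creation_product N')"
      using invariant_form_h_adjoint[OF Y B, of "int i + 1" vac] by simp
    then show ?thesis by (simp add: add h_vac form_zero_left)
  qed
  ultimately show ?thesis by simp
qed

text \<open>
  A creation operator moved to the other side removes exactly one factor there or gives zero, so a
  difference in degree leaves a factor that annihilates the vacuum.
\<close>

lemma form_creation_product_size:
  "size M \<noteq> size N \<Longrightarrow> B (\<theta> (creation_product M)) (creation_product N) = 0"
proof (induction M arbitrary: N)
  case empty
  then show ?case by (auto simp: form_vac_left)
next
  case (add i M)
  show ?case
  proof (cases "i \<in># N")
    case True
    then have "size M \<noteq> size (N - {#i#})"
      using add.prems by (auto simp: size_Diff_singleton dest: multi_member_split)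
    from add.IH[OF this] show ?thesis by (simp only: form_creation_product_add_mset mult_zero_right)
  qed (simp add: form_creation_product_add_mset not_in_iff del: creation_product_add_mset)
qed

lemma form_creation_product:
  assumes "length xs = n" "length ys = n"
  shows "B (\<theta> (creation_product (mset xs))) (creation_product (mset ys)) =
    (\<Sum>\<sigma> | \<sigma> permutes {..<n}. \<Prod>k<n. if xs ! k = ys ! \<sigma> k then of_nat (xs ! k + 1) else 0)"
  using assms
  by (intro pairing_eq_sum_permutations[where P = "\<lambda>M N. B (\<theta> (creation_product M)) (creation_product N)"]
      form_creation_product_add_mset) (simp_all add: form_vac_left[of "{#}", simplified])

end


section \<open>The isometry\<close>

text \<open>
  The monomials with strictly decreasing indices, on which \<open>\<Psi>\<close> is prescribed, already include all
  products of creation operators.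
\<close>

lemma ex_fock_monomial:
  "\<exists>iks. sorted_wrt (\<lambda>x y. fst x > fst y) iks \<and> (\<forall>(i, k)\<in>set iks. k \<ge> 1) \<and>
     mset (concat (map (\<lambda>(i, k). replicate k i) iks)) = M"
  for M :: "nat multiset"
proof -
  define ns where "ns = rev (sorted_list_of_set (set_mset M))"
  have 1: "sorted_wrt (\<lambda>x y. x > y) ns" "set ns = set_mset M" "distinct ns"
    by (simp_all add: ns_def sorted_wrt_rev)
  define iks where "iks = map (\<lambda>i. (i, count M i)) ns"
  have "mset (concat (map (\<lambda>(i, k). replicate k i) iks)) = (\<Sum>i\<leftarrow>ns. replicate_mset (count M i) i)"
    by (simp add: iks_def mset_concat o_def)
  also have "\<dots> = (\<Sum>i\<in>set_mset M. replicate_mset (count M i) i)"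
    using 1 by (simp add: sum_list_distinct_conv_sum_set)
  also have "\<dots> = M"
    by (simp add: multiset_eq_iff count_sum not_in_iff)
  finally show ?thesis
    using 1 by (intro exI[of _ iks]) (auto simp: iks_def sorted_wrt_map)
qed

lemma h_tensor_eq: "h_tensor iks = tensor (map h_fun (concat (map (\<lambda>(i, k). replicate k i) iks)))"
proof -
  have "concat (map (\<lambda>(i, k). replicate k (h_fun i)) iks) =
      map h_fun (concat (map (\<lambda>(i, k). replicate k i) iks))"
    by (induction iks) auto
  then show ?thesis by (simp add: h_tensor_def)
qed

context
  fixes \<Psi> :: "fock \<Rightarrow> nat \<Rightarrow> bergman list \<Rightarrow> complex"
  assumes \<Psi>: "Psi_map \<Psi>"
begin

lemma Psi_add: "\<Psi> (a + b) = \<Psi> a + \<Psi> b"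
  and Psi_scale: "\<Psi> (fock_scale c a) = sym_scale c (\<Psi> a)"
  using \<Psi> by (auto simp: Psi_map_def Vector_Spaces.linear_iff)

lemma Psi_creation_product:
  assumes "p = size M"
  obtains xs where "mset xs = M" "length xs = p"
    "\<Psi> (creation_product M) =
      sym_embed p (\<lambda>gs. of_real (sqrt (fact p)) * sym_op p (tensor (map h_fun xs)) gs)"
proof -
  obtain iks where iks: "sorted_wrt (\<lambda>x y. fst x > fst y) iks" "\<forall>(i, k)\<in>set iks. k \<ge> 1"
    "mset (concat (map (\<lambda>(i, k). replicate k i) iks)) = M"
    using ex_fock_monomial by blast
  define xs where "xs = concat (map (\<lambda>(i, k). replicate k i) iks)"
  have M: "creation_product M = fock_monomial iks"
    by (simp add: fock_monomial_eq_creation_product iks)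
  have embed: "sym_scale c (sym_embed q \<phi>) = sym_embed q (\<lambda>gs. c * \<phi> gs)" for c q \<phi>
    by (auto simp: sym_scale_def sym_embed_def fun_eq_iff)
  have len: "length xs = size M" using iks(3) by (metis size_mset xs_def)
  have *: "\<Psi> (creation_product M) =
      sym_embed (size M) (\<lambda>gs. of_real (sqrt (fact (size M))) * sym_op (size M) (tensor (map h_fun xs)) gs)"
  proof (cases "iks = []")
    case True
    then have "xs = []" "M = {#}" using iks(3) by (simp_all add: xs_def)
    moreover have "sym_op 0 (tensor []) = tensor []"
    proof
      have "{\<sigma>. \<sigma> permutes {..<0::nat}} = {id}" by (simp only: lessThan_0 permutes_empty) simp
      then show "sym_op 0 (tensor []) gs = tensor [] gs" for gs
        by (simp only: sym_op_def) (simp add: tensor_def)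
    qed
    ultimately show ?thesis using \<Psi> by (simp add: Psi_map_def sym_one_def)
  next
    case False
    have "sum_list (map snd iks) = length xs"
      by (simp add: xs_def length_concat o_def case_prod_beta)
    then have "sum_list (map snd iks) = size M" by (simp add: len)
    then have "\<Psi> (fock_monomial iks) =
        sym_scale (of_real (sqrt (fact (size M)))) (sym_embed (size M) (sym_op (size M) (h_tensor iks)))"
      using \<Psi> iks(1,2) False unfolding Psi_map_def Let_def by metis
    then show ?thesis by (simp add: M embed h_tensor_eq xs_def)
  qed
  show ?thesis
    by (rule that[of xs]) (use * iks(3) len \<open>p = size M\<close> in \<open>simp_all add: xs_def\<close>)
qed

lemma Psi_in_graded:
  assumes "\<And>p. 0 \<in> V p" "\<And>p \<phi> \<psi>. \<phi> \<in> V p \<Longrightarrow> \<psi> \<in> V p \<Longrightarrow> \<phi> + \<psi> \<in> V p"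
    "\<And>p \<phi> c. \<phi> \<in> V p \<Longrightarrow> (\<lambda>gs. c * \<phi> gs) \<in> V p"
    "\<And>p fs. length fs = p \<Longrightarrow> sym_op p (tensor fs) \<in> V p"
  shows "\<Psi> a \<in> graded V"
proof (induction a rule: fock_induct)
  case zero
  have "\<Psi> 0 = \<Psi> 0 + \<Psi> 0" using Psi_add[of 0 0] by simp
  then have "\<Psi> 0 = 0" by simp
  then show ?case using assms(1) by (simp add: graded_def zero_fun_def)
next
  case (add a b)
  then show ?case unfolding Psi_add by (intro graded_add[OF assms(2)])
next
  case (scale c a)
  then show ?case unfolding Psi_scale by (intro graded_scale[OF assms(3)])
next
  case (product M)
  obtain xs where "length xs = size M" "\<Psi> (creation_product M) = sym_embed (size M)
      (\<lambda>gs. of_real (sqrt (fact (size M))) * sym_op (size M) (tensor (map h_fun xs)) gs)"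
    using Psi_creation_product[OF refl] by metis
  then show ?case by (simp add: sym_embed_graded[where V = V] assms)
qed

lemma Psi_in_sym_bergman: "\<Psi> a \<in> sym_bergman"
proof -
  have "\<Psi> a \<in> graded (\<lambda>p. sym_op p ` alg_functionals p)"
  proof (rule Psi_in_graded)
    fix p
    have "sym_op p 0 = 0" by (simp add: sym_op_def fun_eq_iff)
    then show "0 \<in> sym_op p ` alg_functionals p" using alg_functionals_zero by (metis imageI)
  next
    fix p \<phi> \<psi> assume "\<phi> \<in> sym_op p ` alg_functionals p" "\<psi> \<in> sym_op p ` alg_functionals p"
    then show "\<phi> + \<psi> \<in> sym_op p ` alg_functionals p"
      by (auto simp flip: sym_op_add intro!: alg_functionals_add)
  next
    fix p \<phi> c assume "\<phi> \<in> sym_op p ` alg_functionals p"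
    then show "(\<lambda>gs. c * \<phi> gs) \<in> sym_op p ` alg_functionals p"
      by (auto simp flip: sym_op_scale intro!: alg_functionals_scale)
  qed (simp add: tensor_in_alg_functionals)
  then show ?thesis using graded_sym_op_subset by blast
qed

lemma Psi_in_graded_alg: "\<Psi> a \<in> graded alg_functionals"
  by (rule Psi_in_graded)
    (auto intro: alg_functionals_zero alg_functionals_add alg_functionals_scale
      sym_op_tensor_in_alg_functionals)

text \<open>
  On both sides stands the permanent of the Gram matrix \<open>(h\<^bsub>i\<^esub>, h\<^bsub>j\<^esub>) = \<delta>\<^bsub>ij\<^esub> (i + 1)\<close>: the factor
  \<open>\<surd>(p!)\<close> in \<open>\<Psi>\<close>, occurring twice, cancels the \<open>1 / p!\<close> of the symmetrised inner product.
\<close>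

lemma Psi_isometric_creation_product:
  assumes "heisenberg_vertex_algebra Y" "normalized_invariant_form Y B" "theta_map \<theta>"
  shows "sym_inner (\<Psi> (creation_product M)) (\<Psi> (creation_product N)) =
    B (\<theta> (creation_product M)) (creation_product N)"
proof -
  define p q where "p = size M" and "q = size N"
  obtain xs where xs: "mset xs = M" "length xs = p" "\<Psi> (creation_product M) =
      sym_embed p (\<lambda>gs. of_real (sqrt (fact p)) * sym_op p (tensor (map h_fun xs)) gs)"
    using Psi_creation_product[OF p_def] by metis
  obtain ys where ys: "mset ys = N" "length ys = q" "\<Psi> (creation_product N) =
      sym_embed q (\<lambda>gs. of_real (sqrt (fact q)) * sym_op q (tensor (map h_fun ys)) gs)"
    using Psi_creation_product[OF q_def] by metis
  have T: "sym_op p (tensor (map h_fun xs)) \<in> alg_functionals p"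
    "sym_op q (tensor (map h_fun ys)) \<in> alg_functionals q"
    using xs ys by (simp_all add: sym_op_tensor_in_alg_functionals)
  show ?thesis
  proof (cases "p = q")
    case False
    then have "B (\<theta> (creation_product M)) (creation_product N) = 0"
      by (intro form_creation_product_size[OF assms]) (simp add: p_def q_def)
    then show ?thesis
      using T False by (simp add: xs(3) ys(3) sym_inner_embed alg_functionals_scale)
  next
    case True
    note T = T[folded True] and ys = ys[folded True]
    define c where "c = complex_of_real (sqrt (fact p))"
    have c: "cnj c * c = fact p"
      by (simp add: c_def flip: of_real_mult) 
    have "sym_inner (\<Psi> (creation_product M)) (\<Psi> (creation_product N)) =
        cnj c * (c * tensor_inner p (sym_op p (tensor (map h_fun xs))) (sym_op p (tensor (map h_fun ys))))"
      unfolding xs(3) ys(3) c_def[symmetric]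
      using T by (simp add: sym_inner_embed alg_functionals_scale tensor_inner_scale_left
          tensor_inner_scale_right)
    also have "\<dots> = fact p * tensor_inner p (sym_op p (tensor (map h_fun xs))) (sym_op p (tensor (map h_fun ys)))"
      by (simp only: mult.assoc[symmetric] c)
    also have "\<dots> = (\<Sum>\<sigma> | \<sigma> permutes {..<p}. \<Prod>i<p. bergman_inner (h_fun (xs ! i)) (h_fun (ys ! \<sigma> i)))"
    proof -
      have "\<sigma> i < p" if "\<sigma> permutes {..<p}" "i < p" for \<sigma> i
        using permutes_in_image[OF that(1), of i] that(2) by simp
      then show ?thesis using xs ys by (simp add: tensor_inner_sym_op)
    qed
    also have "\<dots> = B (\<theta> (creation_product M)) (creation_product N)"
      unfolding xs(1)[symmetric] ys(1)[symmetric]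
      by (simp only: form_creation_product[OF assms xs(2) ys(2)] bergman_inner_h_fun)
    finally show ?thesis .
  qed
qed

end

theorem lemma3p5:
  fixes Y :: "fock \<Rightarrow> int \<Rightarrow> fock \<Rightarrow> fock"
    and B :: "fock \<Rightarrow> fock \<Rightarrow> complex"
    and \<theta> :: "fock \<Rightarrow> fock"
    and \<Psi> :: "fock \<Rightarrow> nat \<Rightarrow> bergman list \<Rightarrow> complex"
  assumes "heisenberg_vertex_algebra Y"
    and "normalized_invariant_form Y B"
    and "theta_map \<theta>"
    and "Psi_map \<Psi>"
  shows "(\<forall>a. \<Psi> a \<in> sym_bergman) \<and>
         (\<forall>a b. sym_inner (\<Psi> a) (\<Psi> b) = B (\<theta> a) b)"
proof (intro conjI allI)
  note Psi = Psi_add[OF assms(4)] Psi_scale[OF assms(4)]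
  note graded = Psi_in_graded_alg[OF assms(4)]
  note form = form_add_left[OF assms(1-3)] form_add_right[OF assms(1-3)]
    form_scale_left[OF assms(1-3)] form_scale_right[OF assms(1-3)]
  have theta: "\<theta> (a + b) = \<theta> a + \<theta> b" "\<theta> (fock_scale c a) = fock_scale (cnj c) (\<theta> a)" for a b c
    using assms(3) by (simp_all add: theta_map_def)
  fix a b
  show "\<Psi> a \<in> sym_bergman" by (rule Psi_in_sym_bergman[OF assms(4)])
  show "sym_inner (\<Psi> a) (\<Psi> b) = B (\<theta> a) b"
  proof (induction a rule: fock_induct)
    case zero
    \<comment> \<open>the zero vector is written as \<open>0 \<cdot> 0\<close>, so that homogeneity makes both sides vanish\<close>
    have "sym_inner (\<Psi> (fock_scale 0 0)) (\<Psi> b) = B (\<theta> (fock_scale 0 0)) b"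
      by (simp only: Psi theta form sym_inner_scale_left graded complex_cnj_zero mult_zero_left)
    then show ?case by simp
  next
    case (add a a')
    then show ?case by (simp only: Psi theta form sym_inner_add_left graded)
  next
    case (scale c a)
    then show ?case by (simp only: Psi theta form sym_inner_scale_left graded)
  next
    case (product M)
    show ?case
    proof (induction b rule: fock_induct)
      case zero
      have "sym_inner (\<Psi> (creation_product M)) (\<Psi> (fock_scale 0 0)) =
          B (\<theta> (creation_product M)) (fock_scale 0 0)"
        by (simp only: Psi form sym_inner_scale_right graded mult_zero_left)
      then show ?case by simp
    next
      case (add a a')
      then show ?case by (simp only: Psi form sym_inner_add_right graded)
    next
      case (scale c a)
      then show ?case by (simp only: Psi form sym_inner_scale_right graded)
    next
      case (product N)
      show ?case by (rule Psi_isometric_creation_product[OF assms(4) assms(1-3)])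
    qed
  qed
qed

end
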